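(* Let $G$ be an almost bunchy graph and let $H \leq_S G$. If $H$ is $\leq_S$-minimal, then $H$ is isomorphic to $G/\sim_G$. In particular, the set $\{K \mid K\leq_S G\}$ has a unique $\leq_S$-minimal element, namely $G/\sim_G$.
   Context: All graphs are finite directed graphs $G$ with state set $V(G)$, edge set $E(G)$, source/target maps $s,t:E(G)\to V(G)$; loops and parallel edges allowed; all graphs sink-free. $E_I(G)=s^{-1}(I)$, $F(I)=t(E_I(G))$, $L(G)$ = finite edge paths, $L_I(G)$ = paths starting at $I$. A homomorphism $\Phi:G\to H$ is a pair of maps on edges and states ($\partial\Phi$ on states) commuting with $s,t$. Graphs are identified up to isomorphism. A right-resolver is a surjective homomorphism $\Phi$ with $\Phi|_{E_I(G)}:E_I(G)\to E_{\partial\Phi(I)}(H)$ bijective for every $I$; $\hom_R(G,H)$, and $H\leq_R G$ if nonempty. For each graph $G$ there is a unique $\leq_R$-minimal $M(G)\leq_R G$, and all right-resolvers $G\to M(G)$ have the same state map $\Sigma_G:V(G)\to V(M(G))$. For $\Phi\in\hom_R(G,H)$, $I\cdot u$ (for $u\in L_{\partial\Phi(I)}(H)$) is the endpoint of the unique lift of $u$ starting at $I$. Stability relation: $I_1\sim_\Phi I_2$ iff $\partial\Phi(I_1)=\partial\Phi(I_2)=:I$ and for all $u\in L_I(H)$ there is $v\in L_{t(u)}(H)$ with $I_1\cdot uv=I_2\cdot uv$; it is an equivalence relation invariant under transitions. $\Phi$ is synchronizing if every $\partial\Phi$-fiber is a single $\sim_\Phi$ class; $H\leq_S G$ if a synchronizing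 right-resolver $G\to H$ exists ($\leq_S$ is a partial order); $\leq_S$-minimal means minimal for this order. $G$ is almost bunchy if for each $I,J\in V(M(G))$ there is at most one $I'\in\Sigma_G^{-1}(I)$ with $|F(I')\cap\Sigma_G^{-1}(J)|\geq 2$. For almost bunchy $G$, the relation $\sim_\Phi$ is the same for all $\Phi\in\hom_R(G,M(G))$; it is denoted $\sim_G$. For $\Phi\in\hom_R(G,M(G))$, the quotient graph $G/\sim_G$ has states the $\sim_G$ classes, edges the classes of edges under $e_1\sim e_2$ iff $\Phi(e_1)=\Phi(e_2)$ and $s(e_1)\sim_G s(e_2)$, with $s,t$ of a class given by the classes of $s,t$ of a representative. *)

theory Defs
  imports "Graph_Theory.Digraph_Isomorphism" "Graph_Theory.Arc_Walk"
begin

section \<open>Graphs, right-resolvers and the two orders\<close>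

text \<open>
  Graphs are finite directed multigraphs (loops and parallel edges allowed, the empty graph not
  excluded) without sinks. Equality of graphs in the mathematical text is isomorphism,
  rendered by \<^const>\<open>digraph_iso\<close>.
\<close>

locale sink_free_graph = fin_digraph G for G :: "('a, 'b) pre_digraph" (structure) +
  assumes sink_free: "I \<in> verts G \<Longrightarrow> out_arcs G I \<noteq> {}"

definition followers :: "('a, 'b) pre_digraph \<Rightarrow> 'a \<Rightarrow> 'a set" where
  "followers G I = head G ` out_arcs G I"

text \<open>
  A homomorphism is a pair of an edge map and a state map. Only the values on the edges and
  states of the source graph matter.
\<close>

type_synonym ('a, 'b, 'c, 'd) graph_map = "('b \<Rightarrow> 'd) \<times> ('a \<Rightarrow> 'c)"

abbreviation edge_map :: "('a, 'b, 'c, 'd) graph_map \<Rightarrow> 'b \<Rightarrow> 'd" where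
  "edge_map \<equiv> fst"

abbreviation state_map :: "('a, 'b, 'c, 'd) graph_map \<Rightarrow> 'a \<Rightarrow> 'c" where
  "state_map \<equiv> snd"

definition graph_hom ::
  "('a, 'b) pre_digraph \<Rightarrow> ('c, 'd) pre_digraph \<Rightarrow> ('a, 'b, 'c, 'd) graph_map set" where
  "graph_hom G H = {\<Phi>.
     edge_map \<Phi> ` arcs G \<subseteq> arcs H \<and> state_map \<Phi> ` verts G \<subseteq> verts H \<and>
     (\<forall>e \<in> arcs G. tail H (edge_map \<Phi> e) = state_map \<Phi> (tail G e) \<and>
                   head H (edge_map \<Phi> e) = state_map \<Phi> (head G e))}"

definition hom_R ::
  "('a, 'b) pre_digraph \<Rightarrow> ('c, 'd) pre_digraph \<Rightarrow> ('a, 'b, 'c, 'd) graph_map set" where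
  "hom_R G H = {\<Phi> \<in> graph_hom G H.
     edge_map \<Phi> ` arcs G = arcs H \<and> state_map \<Phi> ` verts G = verts H \<and>
     (\<forall>I \<in> verts G. bij_betw (edge_map \<Phi>) (out_arcs G I) (out_arcs H (state_map \<Phi> I)))}"

definition leq_R :: "('c, 'd) pre_digraph \<Rightarrow> ('a, 'b) pre_digraph \<Rightarrow> bool" where
  "leq_R H G \<longleftrightarrow> sink_free_graph H \<and> sink_free_graph G \<and> hom_R G H \<noteq> {}"

text \<open>
  \<open>lift_end G \<Phi> I u\<close> is \<open>I \<cdot> u\<close>, the endpoint of the unique lift of \<open>u\<close> along \<open>\<Phi>\<close> starting at \<open>I\<close>.
  It is meaningful for a right-resolver \<open>\<Phi>\<close> on \<open>G\<close> and a path \<open>u\<close> starting at the image of \<open>I\<close>.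
\<close>

definition lift_end ::
  "('a, 'b) pre_digraph \<Rightarrow> ('a, 'b, 'c, 'd) graph_map \<Rightarrow> 'a \<Rightarrow> 'd list \<Rightarrow> 'a" where
  "lift_end G \<Phi> I u = (THE J. \<exists>p. pre_digraph.awalk G I p J \<and> map (edge_map \<Phi>) p = u)"

definition stability ::
  "('a, 'b) pre_digraph \<Rightarrow> ('c, 'd) pre_digraph \<Rightarrow> ('a, 'b, 'c, 'd) graph_map \<Rightarrow> 'a rel" where
  "stability G H \<Phi> = {(I1, I2). I1 \<in> verts G \<and> I2 \<in> verts G \<and>
     state_map \<Phi> I1 = state_map \<Phi> I2 \<and>
     (\<forall>u J. pre_digraph.awalk H (state_map \<Phi> I1) u J \<longrightarrow>
        (\<exists>v J'. pre_digraph.awalk H J v J' \<and>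
           lift_end G \<Phi> I1 (u @ v) = lift_end G \<Phi> I2 (u @ v)))}"

definition synchronizing ::
  "('a, 'b) pre_digraph \<Rightarrow> ('c, 'd) pre_digraph \<Rightarrow> ('a, 'b, 'c, 'd) graph_map \<Rightarrow> bool" where
  "synchronizing G H \<Phi> \<longleftrightarrow>
     (\<forall>J \<in> verts H. {I \<in> verts G. state_map \<Phi> I = J} \<in> verts G // stability G H \<Phi>)"

definition leq_S :: "('c, 'd) pre_digraph \<Rightarrow> ('a, 'b) pre_digraph \<Rightarrow> bool" where
  "leq_S H G \<longleftrightarrow> sink_free_graph H \<and> sink_free_graph G \<and> (\<exists>\<Phi> \<in> hom_R G H. synchronizing G H \<Phi>)"

text \<open>
  Minimality quantifies over all graphs. Every finite graph is isomorphic to one whose states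
  and edges are natural numbers (see \<open>ex_nat_copy\<close> below), so graphs of that type suffice.
\<close>

type_synonym nat_graph = "(nat, nat) pre_digraph"

definition minimal_R :: "('a, 'b) pre_digraph \<Rightarrow> bool" where
  "minimal_R H \<longleftrightarrow> sink_free_graph H \<and> (\<forall>K :: nat_graph. leq_R K H \<longrightarrow> digraph_iso K H)"

definition minimal_S :: "('a, 'b) pre_digraph \<Rightarrow> bool" where
  "minimal_S H \<longleftrightarrow> sink_free_graph H \<and> (\<forall>K :: nat_graph. leq_S K H \<longrightarrow> digraph_iso K H)"

text \<open>\<open>minimal_S_below G H\<close>: \<open>H\<close> is a minimal element of the set of all \<open>K\<close> with \<open>leq_S K G\<close>.\<close>

definition minimal_S_below :: "('a, 'b) pre_digraph \<Rightarrow> ('c, 'd) pre_digraph \<Rightarrow> bool" where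
  "minimal_S_below G H \<longleftrightarrow> leq_S H G \<and>
     (\<forall>K :: nat_graph. leq_S K G \<longrightarrow> leq_S K H \<longrightarrow> digraph_iso K H)"


section \<open>The minimal right-resolved graph, almost bunchy graphs, and the stability quotient\<close>

text \<open>
  The graph \<open>M(G)\<close> is unique up to isomorphism only, so a representative is chosen; likewise a
  right-resolver onto it is chosen in order to name the state map \<open>\<Sigma>\<^sub>G\<close> and the relation
  \<open>\<sim>\<^sub>G\<close>, which do not depend on that choice (the latter for almost bunchy \<open>G\<close>). The lemmas
  \<open>min_graph_leq_R\<close> and \<open>some_resolver_in\<close> below show that the objects chosen exist.
\<close>

definition min_graph :: "('a, 'b) pre_digraph \<Rightarrow> nat_graph" where
  "min_graph G = (SOME M. leq_R M G \<and> minimal_R M)"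

definition some_resolver :: "('a, 'b) pre_digraph \<Rightarrow> ('a, 'b, nat, nat) graph_map" where
  "some_resolver G = (SOME \<Phi>. \<Phi> \<in> hom_R G (min_graph G))"

definition Sigma_map :: "('a, 'b) pre_digraph \<Rightarrow> 'a \<Rightarrow> nat" where
  "Sigma_map G = state_map (some_resolver G)"

definition Sigma_fiber :: "('a, 'b) pre_digraph \<Rightarrow> nat \<Rightarrow> 'a set" where
  "Sigma_fiber G I = {I' \<in> verts G. Sigma_map G I' = I}"

definition almost_bunchy :: "('a, 'b) pre_digraph \<Rightarrow> bool" where
  "almost_bunchy G \<longleftrightarrow>
     (\<forall>I \<in> verts (min_graph G). \<forall>J \<in> verts (min_graph G).
        \<forall>I1 \<in> Sigma_fiber G I. \<forall>I2 \<in> Sigma_fiber G I.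
          card (followers G I1 \<inter> Sigma_fiber G J) \<ge> 2 \<longrightarrow>
          card (followers G I2 \<inter> Sigma_fiber G J) \<ge> 2 \<longrightarrow> I1 = I2)"

definition sim :: "('a, 'b) pre_digraph \<Rightarrow> 'a rel" where
  "sim G = stability G (min_graph G) (some_resolver G)"

definition edge_sim :: "('a, 'b) pre_digraph \<Rightarrow> ('a, 'b, nat, nat) graph_map \<Rightarrow> 'b rel" where
  "edge_sim G \<Phi> = {(e1, e2). e1 \<in> arcs G \<and> e2 \<in> arcs G \<and>
     edge_map \<Phi> e1 = edge_map \<Phi> e2 \<and> (tail G e1, tail G e2) \<in> sim G}"

text \<open>
  The quotient of \<open>G\<close> by \<open>\<sim>\<^sub>G\<close>, formed with a right-resolver \<open>\<Phi>\<close> from \<open>G\<close> to \<open>min_graph G\<close>.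
\<close>

definition quotient_graph ::
  "('a, 'b) pre_digraph \<Rightarrow> ('a, 'b, nat, nat) graph_map \<Rightarrow> ('a set, 'b set) pre_digraph" where
  "quotient_graph G \<Phi> =
     \<lparr> verts = verts G // sim G,
       arcs = arcs G // edge_sim G \<Phi>,
       tail = (\<lambda>c. sim G `` {tail G (SOME e. e \<in> c)}),
       head = (\<lambda>c. sim G `` {head G (SOME e. e \<in> c)}) \<rparr>"


section \<open>Existence of the chosen objects\<close>

lemma hom_R_trans:
  assumes "\<Phi> \<in> hom_R G H" "\<Psi> \<in> hom_R H K" "wf_digraph G"
  shows "(edge_map \<Psi> \<circ> edge_map \<Phi>, state_map \<Psi> \<circ> state_map \<Phi>) \<in> hom_R G K"
proof -
  interpret wf_digraph G by fact
  have img: "edge_map \<Phi> ` arcs G = arcs H" "state_map \<Phi> ` verts G = verts H"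
    "edge_map \<Psi> ` arcs H = arcs K" "state_map \<Psi> ` verts H = verts K"
    using assms by (auto simp: hom_R_def)
  have bij: "bij_betw (edge_map \<Psi> \<circ> edge_map \<Phi>) (out_arcs G I)
      (out_arcs K (state_map \<Psi> (state_map \<Phi> I)))" if "I \<in> verts G" for I
  proof (rule bij_betw_trans)
    show "bij_betw (edge_map \<Phi>) (out_arcs G I) (out_arcs H (state_map \<Phi> I))"
      using assms(1) that by (simp add: hom_R_def)
    have "state_map \<Phi> I \<in> verts H" using that img(2) by blast
    then show "bij_betw (edge_map \<Psi>) (out_arcs H (state_map \<Phi> I))
        (out_arcs K (state_map \<Psi> (state_map \<Phi> I)))"
      using assms(2) by (simp add: hom_R_def)
  qed
  have img': "(edge_map \<Psi> \<circ> edge_map \<Phi>) ` arcs G = arcs K"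
    "(state_map \<Psi> \<circ> state_map \<Phi>) ` verts G = verts K"
    by (simp_all only: image_comp[symmetric] img)
  have "tail K (edge_map \<Psi> (edge_map \<Phi> e)) = state_map \<Psi> (state_map \<Phi> (tail G e)) \<and>
      head K (edge_map \<Psi> (edge_map \<Phi> e)) = state_map \<Psi> (state_map \<Phi> (head G e))"
    if "e \<in> arcs G" for e
  proof -
    have "edge_map \<Phi> e \<in> arcs H" using that img(1) by blast
    then show ?thesis using assms(1,2) that by (simp add: hom_R_def graph_hom_def)
  qed
  then show ?thesis
    unfolding hom_R_def graph_hom_def using bij img' by simp
qed

lemma leq_R_trans: "leq_R K H \<Longrightarrow> leq_R H G \<Longrightarrow> leq_R K G"
  unfolding leq_R_def sink_free_graph_def fin_digraph_def using hom_R_trans by blast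

text \<open>Relabelling along injections gives an isomorphic graph and a right-resolver onto it.\<close>

lemma ex_nat_copy:
  assumes "sink_free_graph G"
  shows "\<exists>K :: nat_graph. digraph_iso G K \<and> leq_R K G"
proof -
  interpret sink_free_graph G by fact
  obtain f :: "'a \<Rightarrow> nat" where f: "inj_on f (verts G)"
    using finite_imp_inj_to_nat_seg[OF finite_verts] by auto
  obtain g :: "'b \<Rightarrow> nat" where g: "inj_on g (arcs G)"
    using finite_imp_inj_to_nat_seg[OF finite_arcs] by auto
  define h where "h = the_inv_into (arcs G) g"
  have h: "h (g e) = e" if "e \<in> arcs G" for e
    using that g by (simp add: h_def the_inv_into_f_f)
  define hom where "hom = \<lparr>iso_verts = f, iso_arcs = g,
    iso_head = (\<lambda>c. f (head G (h c))), iso_tail = (\<lambda>c. f (tail G (h c)))\<rparr>"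
  define K :: nat_graph where "K = app_iso hom G"
  have K: "verts K = f ` verts G" "arcs K = g ` arcs G"
    "\<And>e. e \<in> arcs G \<Longrightarrow> tail K (g e) = f (tail G e)"
    "\<And>e. e \<in> arcs G \<Longrightarrow> head K (g e) = f (head G e)"
    by (auto simp: K_def hom_def app_iso_def h)
  have "digraph_isomorphism hom"
    unfolding digraph_isomorphism_def using f g h wf_digraph by (auto simp: hom_def)
  then have iso: "digraph_iso G K"
    unfolding digraph_iso_def K_def by blast
  have out: "out_arcs K (f I) = g ` out_arcs G I" if "I \<in> verts G" for I
    using that f K by (auto simp: out_arcs_def inj_on_def)
  have sf: "sink_free_graph K"
  proof
    show "out_arcs K I \<noteq> {}" if "I \<in> verts K" for I
      using that K(1) out sink_free by auto
  qed (auto simp: K)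
  have "bij_betw g (out_arcs G I) (out_arcs K (f I))" if "I \<in> verts G" for I
    unfolding out[OF that] using g by (auto simp: bij_betw_def out_arcs_def inj_on_def)
  then have "(g, f) \<in> hom_R G K"
    by (auto simp: hom_R_def graph_hom_def K)
  then show ?thesis
    using iso sf assms by (auto simp: leq_R_def)
qed

lemma leq_R_same_card_iso:
  assumes "leq_R K H" "card (verts H) + card (arcs H) \<le> card (verts K) + card (arcs K)"
  shows "digraph_iso K H"
proof -
  interpret H: sink_free_graph H using assms(1) by (simp add: leq_R_def)
  obtain \<Phi> where \<Phi>: "\<Phi> \<in> hom_R H K" using assms(1) by (auto simp: leq_R_def)
  have img: "verts K = state_map \<Phi> ` verts H" "arcs K = edge_map \<Phi> ` arcs H"
    using \<Phi> by (auto simp: hom_R_def)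
  have "card (verts K) \<le> card (verts H)" "card (arcs K) \<le> card (arcs H)"
    unfolding img by (simp_all add: card_image_le)
  then have "card (verts K) = card (verts H)" "card (arcs K) = card (arcs H)"
    using assms(2) by linarith+
  then have inj: "inj_on (state_map \<Phi>) (verts H)" "inj_on (edge_map \<Phi>) (arcs H)"
    unfolding img by (simp_all add: eq_card_imp_inj_on)
  define hom where "hom = \<lparr>iso_verts = state_map \<Phi>, iso_arcs = edge_map \<Phi>,
    iso_head = head K, iso_tail = tail K\<rparr>"
  have "H.digraph_isomorphism hom"
    unfolding H.digraph_isomorphism_def using inj H.wf_digraph \<Phi>
    by (auto simp: hom_def hom_R_def graph_hom_def)
  moreover have "K = app_iso hom H"
    by (simp add: app_iso_def hom_def img[symmetric])
  ultimately have "digraph_iso H K"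
    unfolding digraph_iso_def by blast
  then show ?thesis
    by (rule digraph_iso_swap[OF H.wf_digraph])
qed

lemma min_graph_leq_R:
  assumes "sink_free_graph G"
  shows "leq_R (min_graph G) G" "minimal_R (min_graph G)"
proof -
  define size where "size = (\<lambda>K :: nat_graph. card (verts K) + card (arcs K))"
  obtain M :: nat_graph where M: "leq_R M G" "\<And>K. leq_R K G \<Longrightarrow> size M \<le> size K"
    using ex_nat_copy[OF assms] ex_has_least_nat[of "\<lambda>K. leq_R K G" _ size] by blast
  have "digraph_iso K M" if "leq_R K M" for K :: nat_graph
    using leq_R_same_card_iso[OF that] M(2)[OF leq_R_trans[OF that M(1)]] by (simp add: size_def)
  then have "leq_R M G \<and> minimal_R M"
    using M(1) by (simp add: minimal_R_def leq_R_def)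
  then have "leq_R (min_graph G) G \<and> minimal_R (min_graph G)"
    unfolding min_graph_def by (rule someI)
  then show "leq_R (min_graph G) G" "minimal_R (min_graph G)" by auto
qed

lemma some_resolver_in:
  assumes "sink_free_graph G"
  shows "some_resolver G \<in> hom_R G (min_graph G)"
  using min_graph_leq_R(1)[OF assms] unfolding some_resolver_def leq_R_def
  by (auto intro: someI)

end

theory Submission
  imports Defs
begin

text \<open>
  Stability of two states is a condition on the pairs reachable from them by equally labelled
  steps. In an almost bunchy graph these pairs, as long as they are off the diagonal, are the same
  for all right-resolvers \<open>\<Phi>\<close> from \<open>G\<close> to \<open>M(G)\<close>, so \<open>\<sim>\<^sub>\<Phi>\<close> does not depend on \<open>\<Phi>\<close>. Let \<open>\<Theta>\<close> be a
  synchronizing right-resolver from \<open>G\<close> to \<open>K\<close>, and compose it with one from \<open>K\<close> to \<open>M(G)\<close>: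
  states identified by \<open>\<Theta>\<close> are then \<open>\<sim>\<^sub>G\<close>-equivalent. Hence the state map \<open>G \<rightarrow> G/\<sim>\<^sub>G\<close> factors
  through \<open>K\<close>, and counting edges lifts the induced state map to a right-resolver
  \<open>K \<rightarrow> G/\<sim>\<^sub>G\<close>, which is again synchronizing. So \<open>G/\<sim>\<^sub>G\<close> is the least element of
  \<open>{K. K \<le>\<^sub>S G}\<close>.
\<close>

section \<open>Lifting walks\<close>

lemma hom_RD:
  assumes "\<Phi> \<in> hom_R G H"
  shows "edge_map \<Phi> ` arcs G = arcs H"
    and "state_map \<Phi> ` verts G = verts H"
    and "e \<in> arcs G \<Longrightarrow> tail H (edge_map \<Phi> e) = state_map \<Phi> (tail G e)"
    and "e \<in> arcs G \<Longrightarrow> head H (edge_map \<Phi> e) = state_map \<Phi> (head G e)"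
    and "I \<in> verts G \<Longrightarrow> bij_betw (edge_map \<Phi>) (out_arcs G I) (out_arcs H (state_map \<Phi> I))"
  using assms by (auto simp: hom_R_def graph_hom_def)

lemma hom_R_arc_lift:
  assumes "\<Phi> \<in> hom_R G H" "I \<in> verts G" "f \<in> arcs H" "tail H f = state_map \<Phi> I"
  obtains e where "e \<in> arcs G" "tail G e = I" "edge_map \<Phi> e = f"
proof -
  have "f \<in> edge_map \<Phi> ` out_arcs G I"
    using hom_RD(5)[OF assms(1,2)] assms(3,4) by (simp add: bij_betw_def)
  then show thesis using that by auto
qed

lemma hom_R_arc_inj:
  assumes "\<Phi> \<in> hom_R G H" "wf_digraph G" "e \<in> arcs G" "e' \<in> arcs G" "tail G e = tail G e'"
    and "edge_map \<Phi> e = edge_map \<Phi> e'"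
  shows "e = e'"
proof -
  have "inj_on (edge_map \<Phi>) (out_arcs G (tail G e))"
    using hom_RD(5)[OF assms(1)] assms(2,3) by (simp add: bij_betw_def wf_digraph.tail_in_verts)
  then show ?thesis using assms(3-6) by (auto dest: inj_onD)
qed

text \<open>Finiteness passes to images, and the out-edges of a state correspond bijectively to
  those of any preimage. Targets of right-resolvers can thus be treated as sink-free graphs
  throughout.\<close>

lemma hom_R_sink_free:
  assumes "sink_free_graph G" "\<Phi> \<in> hom_R G H"
  shows "sink_free_graph H"
proof -
  interpret sink_free_graph G by fact
  note \<Phi> = hom_RD[OF assms(2)]
  show ?thesis
  proof
    show "finite (verts H)" "finite (arcs H)"
      by (simp_all flip: \<Phi>(1,2))
    show "tail H e \<in> verts H" "head H e \<in> verts H" if "e \<in> arcs H" for e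
      using that \<Phi>(3,4) by (auto simp flip: \<Phi>(1,2))
    show "out_arcs H I \<noteq> {}" if I: "I \<in> verts H" for I
    proof -
      obtain I' where I': "I' \<in> verts G" "I = state_map \<Phi> I'"
        using I unfolding \<Phi>(2)[symmetric] by blast
      then show ?thesis using \<Phi>(5)[OF I'(1)] sink_free[OF I'(1)] by (auto simp: bij_betw_def)
    qed
  qed
qed

lemma awalk_end_unique:
  assumes "wf_digraph G" "pre_digraph.awalk G I p J" "pre_digraph.awalk G I p J'"
  shows "J = J'"
proof -
  interpret wf_digraph G by fact
  show ?thesis using assms(2,3)
    by (induction p arbitrary: I) (auto simp: awalk_Nil_iff awalk_Cons_iff)
qed

lemma awalk_hom:
  assumes "\<Phi> \<in> hom_R G H" "wf_digraph G" "wf_digraph H" "pre_digraph.awalk G I p J"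
  shows "pre_digraph.awalk H (state_map \<Phi> I) (map (edge_map \<Phi>) p) (state_map \<Phi> J)"
proof -
  interpret G: wf_digraph G by fact
  interpret H: wf_digraph H by fact
  note \<Phi> = hom_RD[OF assms(1)]
  show ?thesis using assms(4)
  proof (induction p arbitrary: I)
    case Nil
    then show ?case using \<Phi>(2) by (auto simp: G.awalk_Nil_iff H.awalk_Nil_iff)
  next
    case (Cons e p)
    then show ?case using \<Phi>(1,3,4) by (auto simp: G.awalk_Cons_iff H.awalk_Cons_iff)
  qed
qed

text \<open>Injectivity on out-edges forces the lifted edges to coincide one after another. This is
  the uniqueness behind the \<open>THE\<close> in \<open>lift_end\<close>.\<close>

lemma awalk_lift_unique:
  assumes "\<Phi> \<in> hom_R G H" "wf_digraph G"
    and "pre_digraph.awalk G I p J" "pre_digraph.awalk G I q J'"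
    and "map (edge_map \<Phi>) p = map (edge_map \<Phi>) q"
  shows "J = J'"
proof -
  interpret G: wf_digraph G by fact
  show ?thesis using assms(3-)
  proof (induction p arbitrary: I q)
    case Nil
    then show ?case by (auto simp: G.awalk_Nil_iff)
  next
    case (Cons e p)
    then obtain e' q' where q: "q = e' # q'" "edge_map \<Phi> e = edge_map \<Phi> e'"
      "map (edge_map \<Phi>) p = map (edge_map \<Phi>) q'" by (cases q) auto
    have w: "e \<in> arcs G" "e' \<in> arcs G" "tail G e = I" "tail G e' = I"
      "G.awalk (head G e) p J" "G.awalk (head G e') q' J'"
      using Cons.prems(1,2) by (auto simp: G.awalk_Cons_iff q(1))
    then have "e = e'" using hom_R_arc_inj[OF assms(1,2)] q(2) by simp
    then show ?case using Cons.IH w(5,6) q(3) by blast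
  qed
qed

lemma lift_end_eq:
  assumes "\<Phi> \<in> hom_R G H" "wf_digraph G" "pre_digraph.awalk G I p J"
  shows "lift_end G \<Phi> I (map (edge_map \<Phi>) p) = J"
  unfolding lift_end_def using assms by (blast intro: the_equality awalk_lift_unique)

lemma ex_awalk_lift:
  assumes "\<Phi> \<in> hom_R G H" "wf_digraph G" "wf_digraph H"
    and "I \<in> verts G" "pre_digraph.awalk H (state_map \<Phi> I) u J"
  shows "\<exists>p J'. pre_digraph.awalk G I p J' \<and> map (edge_map \<Phi>) p = u"
proof -
  interpret G: wf_digraph G by fact
  interpret H: wf_digraph H by fact
  note \<Phi> = hom_RD[OF assms(1)]
  show ?thesis using assms(4-)
  proof (induction u arbitrary: I)
    case Nil
    then have "G.awalk I [] I" by (simp add: G.awalk_Nil_iff)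
    then show ?case by fastforce
  next
    case (Cons f u)
    then have f: "f \<in> arcs H" "tail H f = state_map \<Phi> I" "H.awalk (head H f) u J"
      by (auto simp: H.awalk_Cons_iff)
    obtain e where e: "e \<in> arcs G" "tail G e = I" "edge_map \<Phi> e = f"
      using hom_R_arc_lift[OF assms(1) Cons.prems(1) f(1,2)] .
    have "H.awalk (state_map \<Phi> (head G e)) u J" using f(3) \<Phi>(4)[OF e(1)] e(3) by simp
    then obtain p J' where "G.awalk (head G e) p J'" "map (edge_map \<Phi>) p = u"
      using Cons.IH G.head_in_verts[OF e(1)] by blast
    then have "G.awalk I (e # p) J' \<and> map (edge_map \<Phi>) (e # p) = f # u"
      using e by (auto simp: G.awalk_Cons_iff)
    then show ?case by (intro exI)
  qed
qed

text \<open>The walk is pushed to \<open>H\<close> and lifted again at \<open>I2\<close>; both lifts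
  end over the end of the pushed walk.\<close>

lemma ex_awalk_transfer:
  assumes "\<Phi> \<in> hom_R G H" "wf_digraph G" "wf_digraph H"
    and "pre_digraph.awalk G I1 p J" "I2 \<in> verts G" "state_map \<Phi> I1 = state_map \<Phi> I2"
  obtains q J' where "pre_digraph.awalk G I2 q J'" "map (edge_map \<Phi>) p = map (edge_map \<Phi>) q"
    "state_map \<Phi> J = state_map \<Phi> J'"
proof -
  have w: "pre_digraph.awalk H (state_map \<Phi> I2) (map (edge_map \<Phi>) p) (state_map \<Phi> J)"
    using awalk_hom[OF assms(1-4)] assms(6) by simp
  obtain q J' where q: "pre_digraph.awalk G I2 q J'" "map (edge_map \<Phi>) q = map (edge_map \<Phi>) p"
    using ex_awalk_lift[OF assms(1-3,5) w] by blast
  have "pre_digraph.awalk H (state_map \<Phi> I2) (map (edge_map \<Phi>) p) (state_map \<Phi> J')"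
    using awalk_hom[OF assms(1-3) q(1)] q(2) by simp
  then have "state_map \<Phi> J = state_map \<Phi> J'"
    using awalk_end_unique[OF assms(3) w] by simp
  then show thesis using that q by simp
qed

section \<open>Stability in terms of pairs of states\<close>

text \<open>These are the edges of the fiber product of \<open>G\<close> with itself over the
  labelling \<open>f\<close>. The labelling is an arbitrary function, so that the edge maps of
  different right-resolvers and composites can be compared on one graph.\<close>

definition pair_step :: "('a, 'b) pre_digraph \<Rightarrow> ('b \<Rightarrow> 'd) \<Rightarrow> ('a \<times> 'a) rel" where
  "pair_step G f = {((tail G e1, tail G e2), (head G e1, head G e2)) | e1 e2.
     e1 \<in> arcs G \<and> e2 \<in> arcs G \<and> f e1 = f e2}"

lemma pair_stepE:
  assumes "((I1, I2), P) \<in> pair_step G f"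
  obtains e1 e2 where "e1 \<in> arcs G" "e2 \<in> arcs G" "f e1 = f e2" "tail G e1 = I1" "tail G e2 = I2"
    "P = (head G e1, head G e2)"
  using assms unfolding pair_step_def by blast

lemma pair_stepI:
  "e1 \<in> arcs G \<Longrightarrow> e2 \<in> arcs G \<Longrightarrow> f e1 = f e2 \<Longrightarrow> tail G e1 = I1 \<Longrightarrow> tail G e2 = I2 \<Longrightarrow>
   head G e1 = J1 \<Longrightarrow> head G e2 = J2 \<Longrightarrow> ((I1, I2), (J1, J2)) \<in> pair_step G f"
  unfolding pair_step_def by blast

lemma pair_steps_iff_awalks:
  assumes "wf_digraph G" "I1 \<in> verts G" "I2 \<in> verts G"
  shows "((I1, I2), (J1, J2)) \<in> (pair_step G f)\<^sup>* \<longleftrightarrow>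
    (\<exists>p1 p2. pre_digraph.awalk G I1 p1 J1 \<and> pre_digraph.awalk G I2 p2 J2 \<and> map f p1 = map f p2)"
proof -
  interpret G: wf_digraph G by fact
  show ?thesis
  proof
    assume "((I1, I2), (J1, J2)) \<in> (pair_step G f)\<^sup>*"
    then show "\<exists>p1 p2. G.awalk I1 p1 J1 \<and> G.awalk I2 p2 J2 \<and> map f p1 = map f p2"
      using assms(2,3)
    proof (induction "(I1, I2)" arbitrary: I1 I2 rule: converse_rtrancl_induct)
      case base
      then have "G.awalk J1 [] J1 \<and> G.awalk J2 [] J2" by (simp add: G.awalk_Nil_iff)
      then show ?case by blast
    next
      case (step P)
      obtain e1 e2 where e: "e1 \<in> arcs G" "e2 \<in> arcs G" "f e1 = f e2" "tail G e1 = I1"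
        "tail G e2 = I2" "P = (head G e1, head G e2)" using pair_stepE[OF step(1)] .
      obtain p1 p2 where "G.awalk (head G e1) p1 J1" "G.awalk (head G e2) p2 J2" "map f p1 = map f p2"
        using step(3)[OF e(6)] e by auto
      then have "G.awalk I1 (e1 # p1) J1 \<and> G.awalk I2 (e2 # p2) J2 \<and> map f (e1 # p1) = map f (e2 # p2)"
        using e by (auto simp: G.awalk_Cons_iff)
      then show ?case by blast
    qed
  next
    assume "\<exists>p1 p2. G.awalk I1 p1 J1 \<and> G.awalk I2 p2 J2 \<and> map f p1 = map f p2"
    then obtain p1 p2 where "G.awalk I1 p1 J1" "G.awalk I2 p2 J2" "map f p1 = map f p2" by blast
    then show "((I1, I2), (J1, J2)) \<in> (pair_step G f)\<^sup>*"
    proof (induction p1 arbitrary: p2 I1 I2)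
      case Nil
      then show ?case by (auto simp: G.awalk_Nil_iff)
    next
      case (Cons e1 p1)
      then obtain e2 p2' where p2: "p2 = e2 # p2'" by (cases p2) auto
      with Cons.prems have "((I1, I2), (head G e1, head G e2)) \<in> pair_step G f"
        by (auto simp: G.awalk_Cons_iff intro: pair_stepI)
      moreover have "((head G e1, head G e2), (J1, J2)) \<in> (pair_step G f)\<^sup>*"
        using Cons by (auto simp: G.awalk_Cons_iff p2)
      ultimately show ?case by (rule converse_rtrancl_into_rtrancl)
    qed
  qed
qed

text \<open>The image of an edge determines the image of its head, so each step ends in a common
  fiber; the hypotheses on \<open>I1\<close> and \<open>I2\<close> settle the empty sequence of
  steps.\<close>

lemma pair_steps_state_map:
  assumes "\<Phi> \<in> hom_R G H" "wf_digraph G"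
    and "((I1, I2), (J1, J2)) \<in> (pair_step G (edge_map \<Phi>))\<^sup>*"
    and "I1 \<in> verts G" "I2 \<in> verts G" "state_map \<Phi> I1 = state_map \<Phi> I2"
  shows "J1 \<in> verts G \<and> J2 \<in> verts G \<and> state_map \<Phi> J1 = state_map \<Phi> J2"
  using assms(3)
proof (induction "(J1, J2)" arbitrary: J1 J2 rule: rtrancl_induct)
  case base
  then show ?case using assms(4-6) by simp
next
  case (step P)
  obtain I1' I2' where P: "P = (I1', I2')" by fastforce
  obtain e1 e2 where e: "e1 \<in> arcs G" "e2 \<in> arcs G" "edge_map \<Phi> e1 = edge_map \<Phi> e2"
    "head G e1 = J1" "head G e2 = J2"
    using step(2) unfolding P by (blast elim: pair_stepE)
  then show ?case
    using hom_RD(4)[OF assms(1), of e1] hom_RD(4)[OF assms(1), of e2] assms(2)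
    by (auto dest: wf_digraph.head_in_verts)
qed

text \<open>Pairs of lifts of one path of \<open>H\<close> are exactly pairs of equally labelled
  walks in \<open>G\<close>, and a common lift end is a pair on the diagonal. Paths of
  \<open>H\<close> and \<open>lift_end\<close> are thereby replaced by reachability between
  pairs.\<close>

lemma stability_iff_pair_steps:
  assumes "\<Phi> \<in> hom_R G H" "wf_digraph G" "wf_digraph H"
  shows "(I1, I2) \<in> stability G H \<Phi> \<longleftrightarrow>
    I1 \<in> verts G \<and> I2 \<in> verts G \<and> state_map \<Phi> I1 = state_map \<Phi> I2 \<and>
    (\<forall>J1 J2. ((I1, I2), (J1, J2)) \<in> (pair_step G (edge_map \<Phi>))\<^sup>* \<longrightarrow>
       (\<exists>K. ((J1, J2), (K, K)) \<in> (pair_step G (edge_map \<Phi>))\<^sup>*))"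
    (is "?L \<longleftrightarrow> ?V1 \<and> ?V2 \<and> ?E \<and> ?R")
proof (cases "?V1 \<and> ?V2 \<and> ?E")
  case False
  then show ?thesis by (auto simp: stability_def)
next
  case True
  interpret G: wf_digraph G by fact
  interpret H: wf_digraph H by fact
  note V = True[THEN conjunct1] True[THEN conjunct2, THEN conjunct1]
  note E = True[THEN conjunct2, THEN conjunct2]
  note lift = lift_end_eq[OF assms(1,2)]
  have "?R" if L: "?L"
  proof (intro allI impI)
    fix J1 J2 assume steps: "((I1, I2), (J1, J2)) \<in> (pair_step G (edge_map \<Phi>))\<^sup>*"
    then obtain p1 p2 where p: "G.awalk I1 p1 J1" "G.awalk I2 p2 J2"
      "map (edge_map \<Phi>) p1 = map (edge_map \<Phi>) p2"
      using pair_steps_iff_awalks[OF assms(2) V] by blast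
    obtain v J' where v: "H.awalk (state_map \<Phi> J1) v J'"
      "lift_end G \<Phi> I1 (map (edge_map \<Phi>) p1 @ v) = lift_end G \<Phi> I2 (map (edge_map \<Phi>) p1 @ v)"
      using L awalk_hom[OF assms p(1)] unfolding stability_def by blast
    have J: "J1 \<in> verts G" "J2 \<in> verts G" using p(1,2) by auto
    obtain q1 K1 where q1: "G.awalk J1 q1 K1" "map (edge_map \<Phi>) q1 = v"
      using ex_awalk_lift[OF assms J(1) v(1)] by blast
    have "state_map \<Phi> J1 = state_map \<Phi> J2"
      using pair_steps_state_map[OF assms(1,2) steps V E] by blast
    then obtain q2 K2 where q2: "G.awalk J2 q2 K2" "map (edge_map \<Phi>) q1 = map (edge_map \<Phi>) q2"
      using ex_awalk_transfer[OF assms q1(1) J(2)] by blast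
    \<comment> \<open>\<open>K1\<close> and \<open>K2\<close> are the ends of the two lifts of the
      same path, each composed of an initial walk and its continuation.\<close>
    have "K1 = K2"
      using v(2) lift[OF G.awalk_appendI[OF p(1) q1(1)]] lift[OF G.awalk_appendI[OF p(2) q2(1)]]
        q1(2) q2(2) p(3) by simp
    then show "\<exists>K. ((J1, J2), (K, K)) \<in> (pair_step G (edge_map \<Phi>))\<^sup>*"
      using pair_steps_iff_awalks[OF assms(2) J] q1(1) q2 by blast
  qed
  moreover have "?L" if R: "?R"
  proof -
    have "\<exists>v J'. H.awalk J v J' \<and> lift_end G \<Phi> I1 (u @ v) = lift_end G \<Phi> I2 (u @ v)"
      if u: "H.awalk (state_map \<Phi> I1) u J" for u J
    proof -
      obtain p1 J1 where p1: "G.awalk I1 p1 J1" "map (edge_map \<Phi>) p1 = u"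
        using ex_awalk_lift[OF assms V(1) u] by blast
      then obtain p2 J2 where p2: "G.awalk I2 p2 J2" "map (edge_map \<Phi>) p1 = map (edge_map \<Phi>) p2"
        using ex_awalk_transfer[OF assms p1(1) V(2) E] by blast
      have J: "J1 \<in> verts G" "J2 \<in> verts G" using p1(1) p2(1) by auto
      obtain K where "((J1, J2), (K, K)) \<in> (pair_step G (edge_map \<Phi>))\<^sup>*"
        using R pair_steps_iff_awalks[OF assms(2) V] p1(1) p2 by blast
      then obtain q1 q2 where q: "G.awalk J1 q1 K" "G.awalk J2 q2 K"
        "map (edge_map \<Phi>) q1 = map (edge_map \<Phi>) q2"
        using pair_steps_iff_awalks[OF assms(2) J] by blast
      \<comment> \<open>\<open>J\<close> is given only as the end of \<open>u\<close>. It is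
        identified with the image of \<open>J1\<close>, so that the image of \<open>q1\<close> is an
        admissible \<open>v\<close>.\<close>
      have "H.awalk (state_map \<Phi> I1) u (state_map \<Phi> J1)"
        using awalk_hom[OF assms p1(1)] p1(2) by simp
      then have "J = state_map \<Phi> J1" by (rule awalk_end_unique[OF assms(3) u])
      then have "H.awalk J (map (edge_map \<Phi>) q1) (state_map \<Phi> K)"
        using awalk_hom[OF assms q(1)] by simp
      moreover have "lift_end G \<Phi> I1 (u @ map (edge_map \<Phi>) q1) = lift_end G \<Phi> I2 (u @ map (edge_map \<Phi>) q1)"
        using lift[OF G.awalk_appendI[OF p1(1) q(1)]] lift[OF G.awalk_appendI[OF p2(1) q(2)]]
          p1(2) p2(2) q(3) by simp
      ultimately show ?thesis by blast
    qed
    then show ?thesis using V E by (auto simp: stability_def)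
  qed
  ultimately show ?thesis using True by blast
qed

lemma stability_invariant:
  assumes "\<Phi> \<in> hom_R G H" "wf_digraph G" "wf_digraph H"
    and "(I1, I2) \<in> stability G H \<Phi>"
    and "((I1, I2), (J1, J2)) \<in> (pair_step G (edge_map \<Phi>))\<^sup>*"
  shows "(J1, J2) \<in> stability G H \<Phi>"
proof -
  note iff = stability_iff_pair_steps[OF assms(1-3)]
  have "J1 \<in> verts G \<and> J2 \<in> verts G \<and> state_map \<Phi> J1 = state_map \<Phi> J2"
    using pair_steps_state_map[OF assms(1,2,5)] assms(4) by (simp add: iff)
  then show ?thesis
    using assms(4,5) unfolding iff by (meson rtrancl_trans)
qed

text \<open>The first two components are merged while a walk from the third is carried along with
  the same labels. The second and third components then form a pair still reachable from
  \<open>(I2, I3)\<close>, which can be merged in turn.\<close>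

lemma stability_trans:
  assumes "\<Phi> \<in> hom_R G H" "wf_digraph G" "wf_digraph H"
    and "(I1, I2) \<in> stability G H \<Phi>" "(I2, I3) \<in> stability G H \<Phi>"
  shows "(I1, I3) \<in> stability G H \<Phi>"
proof -
  interpret G: wf_digraph G by fact
  note iff = stability_iff_pair_steps[OF assms(1-3)]
  note walks = pair_steps_iff_awalks[OF assms(2)]
  note V = assms(4,5)[unfolded iff]
  have "\<exists>K. ((J1, J3), (K, K)) \<in> (pair_step G (edge_map \<Phi>))\<^sup>*"
    if "((I1, I3), (J1, J3)) \<in> (pair_step G (edge_map \<Phi>))\<^sup>*" for J1 J3
  proof -
    obtain p1 p3 where p: "G.awalk I1 p1 J1" "G.awalk I3 p3 J3"
      "map (edge_map \<Phi>) p1 = map (edge_map \<Phi>) p3"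
      using \<open>((I1, I3), (J1, J3)) \<in> _\<close> walks V by blast
    have J: "J1 \<in> verts G" "J3 \<in> verts G" using p(1,2) by auto
    obtain p2 J2 where p2: "G.awalk I2 p2 J2" "map (edge_map \<Phi>) p1 = map (edge_map \<Phi>) p2"
      using ex_awalk_transfer[OF assms(1-3) p(1)] V by metis
    have J2: "J2 \<in> verts G" using p2(1) by auto
    have "((I1, I2), (J1, J2)) \<in> (pair_step G (edge_map \<Phi>))\<^sup>*"
      using walks V p p2 by blast
    then obtain K where K: "((J1, J2), (K, K)) \<in> (pair_step G (edge_map \<Phi>))\<^sup>*" using V by blast
    then obtain q1 q2 where q: "G.awalk J1 q1 K" "G.awalk J2 q2 K"
      "map (edge_map \<Phi>) q1 = map (edge_map \<Phi>) q2"
      using walks[OF J(1) J2] by blast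
    have step23: "((I2, I3), (J2, J3)) \<in> (pair_step G (edge_map \<Phi>))\<^sup>*"
      using walks V p p2 by metis
    then have "state_map \<Phi> J2 = state_map \<Phi> J3"
      using pair_steps_state_map[OF assms(1,2) step23] V by blast
    then obtain q3 L where q3: "G.awalk J3 q3 L" "map (edge_map \<Phi>) q2 = map (edge_map \<Phi>) q3"
      using ex_awalk_transfer[OF assms(1-3) q(2) J(2)] by metis
    \<comment> \<open>\<open>K\<close> is the common end of the first two walks, so merging
      \<open>K\<close> with \<open>L\<close> merges the first and the third component as
      well.\<close>
    have "((J2, J3), (K, L)) \<in> (pair_step G (edge_map \<Phi>))\<^sup>*"
      using walks[OF J2 J(2)] q q3 by blast
    then obtain N where "((K, L), (N, N)) \<in> (pair_step G (edge_map \<Phi>))\<^sup>*"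
      using V step23 by (meson rtrancl_trans)
    moreover have "((J1, J3), (K, L)) \<in> (pair_step G (edge_map \<Phi>))\<^sup>*"
      using walks[OF J] q q3 by metis
    ultimately show ?thesis by (meson rtrancl_trans)
  qed
  then show ?thesis using V unfolding iff by simp
qed

lemma pair_steps_sym:
  "((I1, I2), (J1, J2)) \<in> (pair_step G f)\<^sup>* \<Longrightarrow> ((I2, I1), (J2, J1)) \<in> (pair_step G f)\<^sup>*"
proof (induction "(J1, J2)" arbitrary: J1 J2 rule: rtrancl_induct)
  case base
  then show ?case by simp
next
  case (step P)
  obtain K1 K2 where P: "P = (K1, K2)" by fastforce
  have "((K2, K1), (J2, J1)) \<in> pair_step G f"
    using step(2) unfolding P by (elim pair_stepE) (simp add: pair_stepI)
  then show ?case using step(3)[OF P] by simp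
qed

lemma equiv_stability:
  assumes "\<Phi> \<in> hom_R G H" "wf_digraph G" "wf_digraph H"
  shows "equiv (verts G) (stability G H \<Phi>)"
proof (rule equivI)
  note iff = stability_iff_pair_steps[OF assms]
  show "stability G H \<Phi> \<subseteq> verts G \<times> verts G" by (auto simp: stability_def)
  show "refl_on (verts G) (stability G H \<Phi>)"
  proof (rule refl_onI)
    fix I assume I: "I \<in> verts G"
    \<comment> \<open>Equally labelled walks from one state have the same end, so every pair
      reachable from the diagonal is on the diagonal.\<close>
    have "J1 = J2" if "((I, I), (J1, J2)) \<in> (pair_step G (edge_map \<Phi>))\<^sup>*" for J1 J2
      using that pair_steps_iff_awalks[OF assms(2) I I] awalk_lift_unique[OF assms(1,2)] by blast
    then show "(I, I) \<in> stability G H \<Phi>" using I unfolding iff by blast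
  qed
  show "sym (stability G H \<Phi>)"
  proof (rule symI)
    fix I1 I2 assume "(I1, I2) \<in> stability G H \<Phi>"
    then show "(I2, I1) \<in> stability G H \<Phi>"
      unfolding iff by (metis pair_steps_sym)
  qed
  show "trans (stability G H \<Phi>)"
    using stability_trans[OF assms] by (blast intro: transI)
qed

text \<open>Two edges that start in one fiber of \<open>\<pi>\<close> have images with a common
  tail; injectivity of \<open>\<Psi>\<close> on out-edges then turns equal composite labels into
  equal labels under \<open>\<pi>\<close>. Every pair reached lies again in a common fiber, so this
  applies at each step.\<close>

lemma pair_steps_comp_iff:
  assumes "\<pi> \<in> hom_R G H" "\<Psi> \<in> hom_R H M" "wf_digraph G" "wf_digraph H"
    and "I1 \<in> verts G" "I2 \<in> verts G" "state_map \<pi> I1 = state_map \<pi> I2"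
  shows "((I1, I2), P) \<in> (pair_step G (edge_map \<Psi> \<circ> edge_map \<pi>))\<^sup>* \<longleftrightarrow>
    ((I1, I2), P) \<in> (pair_step G (edge_map \<pi>))\<^sup>*"
proof
  assume "((I1, I2), P) \<in> (pair_step G (edge_map \<pi>))\<^sup>*"
  moreover have "pair_step G (edge_map \<pi>) \<subseteq> pair_step G (edge_map \<Psi> \<circ> edge_map \<pi>)"
    unfolding pair_step_def by fastforce
  ultimately show "((I1, I2), P) \<in> (pair_step G (edge_map \<Psi> \<circ> edge_map \<pi>))\<^sup>*"
    using rtrancl_mono by blast
next
  assume "((I1, I2), P) \<in> (pair_step G (edge_map \<Psi> \<circ> edge_map \<pi>))\<^sup>*"
  then show "((I1, I2), P) \<in> (pair_step G (edge_map \<pi>))\<^sup>*"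
  proof (induction rule: rtrancl_induct)
    case base
    then show ?case by simp
  next
    case (step P Q)
    obtain J1 J2 where P: "P = (J1, J2)" by fastforce
    obtain e1 e2 where e: "e1 \<in> arcs G" "e2 \<in> arcs G" "tail G e1 = J1" "tail G e2 = J2"
      "(edge_map \<Psi> \<circ> edge_map \<pi>) e1 = (edge_map \<Psi> \<circ> edge_map \<pi>) e2" "Q = (head G e1, head G e2)"
      using pair_stepE[OF step(2)[unfolded P]] by metis
    have "state_map \<pi> J1 = state_map \<pi> J2"
      using pair_steps_state_map[OF assms(1,3) step(3)[unfolded P] assms(5-7)] by blast
    moreover have "edge_map \<pi> e1 \<in> arcs H" "edge_map \<pi> e2 \<in> arcs H"
      using hom_RD(1)[OF assms(1)] e(1,2) by auto
    ultimately have "edge_map \<pi> e1 = edge_map \<pi> e2"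
      using hom_R_arc_inj[OF assms(2,4)] hom_RD(3)[OF assms(1)] e by simp
    then have "(P, Q) \<in> pair_step G (edge_map \<pi>)"
      using e unfolding P by (auto intro: pair_stepI)
    then show ?case using step(3) by simp
  qed
qed

text \<open>On pairs inside a fiber of \<open>\<pi>\<close> both labellings allow the same sequences
  of steps, so the two stability conditions agree there. This relates a resolver onto an
  intermediate graph to one onto the minimal graph.\<close>

lemma stability_comp:
  assumes "\<pi> \<in> hom_R G H" "\<Psi> \<in> hom_R H M" "sink_free_graph G"
    and "\<Phi> = (edge_map \<Psi> \<circ> edge_map \<pi>, state_map \<Psi> \<circ> state_map \<pi>)"
  shows "(I1, I2) \<in> stability G H \<pi> \<longleftrightarrow>
    (I1, I2) \<in> stability G M \<Phi> \<and> state_map \<pi> I1 = state_map \<pi> I2"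
proof -
  have H: "sink_free_graph H" using hom_R_sink_free assms(1,3) by blast
  then have M: "sink_free_graph M" using hom_R_sink_free assms(2) by blast
  interpret G: sink_free_graph G by fact
  interpret H: sink_free_graph H by fact
  interpret M: sink_free_graph M by fact
  have \<Phi>: "\<Phi> \<in> hom_R G M"
    unfolding assms(4) by (rule hom_R_trans[OF assms(1,2) G.wf_digraph_axioms])
  note iff = stability_iff_pair_steps[OF assms(1) G.wf_digraph_axioms H.wf_digraph_axioms]
    stability_iff_pair_steps[OF \<Phi> G.wf_digraph_axioms M.wf_digraph_axioms]
  have comp: "((J1, J2), P) \<in> (pair_step G (edge_map \<Phi>))\<^sup>* \<longleftrightarrow>
    ((J1, J2), P) \<in> (pair_step G (edge_map \<pi>))\<^sup>*"
    if "J1 \<in> verts G" "J2 \<in> verts G" "state_map \<pi> J1 = state_map \<pi> J2" for J1 J2 P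
    using pair_steps_comp_iff[OF assms(1,2) G.wf_digraph_axioms H.wf_digraph_axioms that]
    by (simp add: assms(4))
  show ?thesis
  proof (cases "I1 \<in> verts G \<and> I2 \<in> verts G \<and> state_map \<pi> I1 = state_map \<pi> I2")
    case False
    then show ?thesis unfolding iff by blast
  next
    case True
    have "state_map \<Phi> I1 = state_map \<Phi> I2" using True by (simp add: assms(4))
    moreover have "((I1, I2), P) \<in> (pair_step G (edge_map \<Phi>))\<^sup>* \<longleftrightarrow>
        ((I1, I2), P) \<in> (pair_step G (edge_map \<pi>))\<^sup>*" for P
      using True comp by simp
    moreover have "((J1, J2), P) \<in> (pair_step G (edge_map \<Phi>))\<^sup>* \<longleftrightarrow>
        ((J1, J2), P) \<in> (pair_step G (edge_map \<pi>))\<^sup>*"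
      if "((I1, I2), (J1, J2)) \<in> (pair_step G (edge_map \<pi>))\<^sup>*" for J1 J2 P
      using pair_steps_state_map[OF assms(1) G.wf_digraph_axioms that] True
      by (intro comp) simp_all
    ultimately show ?thesis using True by (simp add: iff cong: imp_cong)
  qed
qed

text \<open>Stable states always share a fiber, so every class is part of a fiber, and a fiber is a
  single class once all its pairs are stable. Surjectivity on states makes every fiber
  nonempty.\<close>

lemma synchronizing_iff:
  assumes "\<Phi> \<in> hom_R G H" "wf_digraph G" "wf_digraph H"
  shows "synchronizing G H \<Phi> \<longleftrightarrow>
    (\<forall>I1 \<in> verts G. \<forall>I2 \<in> verts G. state_map \<Phi> I1 = state_map \<Phi> I2 \<longrightarrow> (I1, I2) \<in> stability G H \<Phi>)"
proof -
  note eq = equiv_stability[OF assms]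
  have ker: "I2 \<in> verts G \<and> state_map \<Phi> I1 = state_map \<Phi> I2"
    if "(I1, I2) \<in> stability G H \<Phi>" for I1 I2
    using that by (simp add: stability_def)
  show ?thesis
  proof (intro iffI ballI impI)
    fix I1 I2 assume sync: "synchronizing G H \<Phi>"
      and I: "I1 \<in> verts G" "I2 \<in> verts G" "state_map \<Phi> I1 = state_map \<Phi> I2"
    have "state_map \<Phi> I2 \<in> verts H" using I(2) hom_RD(2)[OF assms(1)] by blast
    then have C: "{I \<in> verts G. state_map \<Phi> I = state_map \<Phi> I2} \<in> verts G // stability G H \<Phi>"
      using sync by (simp add: synchronizing_def)
    show "(I1, I2) \<in> stability G H \<Phi>"
      by (rule in_quotient_imp_in_rel[OF eq C]) (use I in auto)
  next
    assume *: "\<forall>I1 \<in> verts G. \<forall>I2 \<in> verts G. state_map \<Phi> I1 = state_map \<Phi> I2 \<longrightarrow>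
      (I1, I2) \<in> stability G H \<Phi>"
    show "synchronizing G H \<Phi>" unfolding synchronizing_def
    proof
      fix J assume "J \<in> verts H"
      then obtain I where I: "I \<in> verts G" "J = state_map \<Phi> I"
        using hom_RD(2)[OF assms(1)] by blast
      have "{I' \<in> verts G. state_map \<Phi> I' = J} = stability G H \<Phi> `` {I}"
        unfolding I(2) using I(1) * by (blast dest: ker intro: sym)
      then show "{I' \<in> verts G. state_map \<Phi> I' = J} \<in> verts G // stability G H \<Phi>"
        using I(1) by (simp add: quotientI)
    qed
  qed
qed

lemma pair_steps_push:
  assumes "\<Theta> \<in> hom_R G K"
    and "((I1, I2), (J1, J2)) \<in> (pair_step G (f \<circ> edge_map \<Theta>))\<^sup>*"
  shows "((state_map \<Theta> I1, state_map \<Theta> I2), (state_map \<Theta> J1, state_map \<Theta> J2)) \<in> (pair_step K f)\<^sup>*"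
  using assms(2)
proof (induction "(J1, J2)" arbitrary: J1 J2 rule: rtrancl_induct)
  case base
  then show ?case by simp
next
  case (step P)
  obtain L1 L2 where P: "P = (L1, L2)" by fastforce
  obtain e1 e2 where "e1 \<in> arcs G" "e2 \<in> arcs G" "(f \<circ> edge_map \<Theta>) e1 = (f \<circ> edge_map \<Theta>) e2"
    "tail G e1 = L1" "tail G e2 = L2" "head G e1 = J1" "head G e2 = J2"
    using step(2) unfolding P by (blast elim: pair_stepE)
  then have "((state_map \<Theta> L1, state_map \<Theta> L2), (state_map \<Theta> J1, state_map \<Theta> J2)) \<in> pair_step K f"
    using hom_RD(1,3,4)[OF assms(1)]
    by (intro pair_stepI[of "edge_map \<Theta> e1" _ "edge_map \<Theta> e2"]) auto
  then show ?case using step(3)[OF P] by simp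
qed

text \<open>The steps in \<open>K\<close> are lifted one at a time, each edge at the current state
  of its own component.\<close>

lemma pair_steps_pull:
  assumes "\<Theta> \<in> hom_R G K" "wf_digraph G" "I1 \<in> verts G" "I2 \<in> verts G"
    and "((state_map \<Theta> I1, state_map \<Theta> I2), (L1, L2)) \<in> (pair_step K f)\<^sup>*"
  obtains J1 J2 where "((I1, I2), (J1, J2)) \<in> (pair_step G (f \<circ> edge_map \<Theta>))\<^sup>*"
    "J1 \<in> verts G" "J2 \<in> verts G" "L1 = state_map \<Theta> J1" "L2 = state_map \<Theta> J2"
proof -
  have "\<exists>J1 J2. ((I1, I2), (J1, J2)) \<in> (pair_step G (f \<circ> edge_map \<Theta>))\<^sup>* \<and>
    J1 \<in> verts G \<and> J2 \<in> verts G \<and> L1 = state_map \<Theta> J1 \<and> L2 = state_map \<Theta> J2"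
    using assms(5)
  proof (induction "(L1, L2)" arbitrary: L1 L2 rule: rtrancl_induct)
    case base
    then show ?case using assms(3,4) by blast
  next
    case (step P)
    obtain N1 N2 where P: "P = (N1, N2)" by fastforce
    obtain J1 J2 where J: "((I1, I2), (J1, J2)) \<in> (pair_step G (f \<circ> edge_map \<Theta>))\<^sup>*"
      "J1 \<in> verts G" "J2 \<in> verts G" "N1 = state_map \<Theta> J1" "N2 = state_map \<Theta> J2"
      using step(3)[OF P] by blast
    obtain f1 f2 where f: "f1 \<in> arcs K" "f2 \<in> arcs K" "f f1 = f f2"
      "tail K f1 = N1" "tail K f2 = N2" "head K f1 = L1" "head K f2 = L2"
      using step(2) unfolding P by (blast elim: pair_stepE)
    obtain e1 where e1: "e1 \<in> arcs G" "tail G e1 = J1" "edge_map \<Theta> e1 = f1"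
      using hom_R_arc_lift[OF assms(1) J(2) f(1)] f(4) J(4) by metis
    obtain e2 where e2: "e2 \<in> arcs G" "tail G e2 = J2" "edge_map \<Theta> e2 = f2"
      using hom_R_arc_lift[OF assms(1) J(3) f(2)] f(5) J(5) by metis
    have "((J1, J2), (head G e1, head G e2)) \<in> pair_step G (f \<circ> edge_map \<Theta>)"
      using e1 e2 f(3) by (intro pair_stepI[of e1 _ e2]) auto
    then have "((I1, I2), (head G e1, head G e2)) \<in> (pair_step G (f \<circ> edge_map \<Theta>))\<^sup>*"
      using J(1) by simp
    moreover have "L1 = state_map \<Theta> (head G e1)" "L2 = state_map \<Theta> (head G e2)"
      using hom_RD(4)[OF assms(1)] e1 e2 f by auto
    ultimately show ?case using e1(1) e2(1) assms(2) wf_digraph.head_in_verts by metis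
  qed
  then show thesis using that by blast
qed

text \<open>Steps from a pair in \<open>K\<close> are pulled back to \<open>G\<close>, merged there
  by stability for the composite, and the merging steps are pushed forward again.\<close>

lemma synchronizing_right_factor:
  assumes "\<Theta> \<in> hom_R G K" "\<Xi> \<in> hom_R K N" "sink_free_graph G"
    and "synchronizing G N (edge_map \<Xi> \<circ> edge_map \<Theta>, state_map \<Xi> \<circ> state_map \<Theta>)"
  shows "synchronizing K N \<Xi>"
proof -
  have K: "sink_free_graph K" using hom_R_sink_free assms(1,3) by blast
  then have N: "sink_free_graph N" using hom_R_sink_free assms(2) by blast
  interpret G: sink_free_graph G by fact
  interpret K: sink_free_graph K by fact
  interpret N: sink_free_graph N by fact
  let ?\<pi> = "(edge_map \<Xi> \<circ> edge_map \<Theta>, state_map \<Xi> \<circ> state_map \<Theta>)"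
  have \<pi>: "?\<pi> \<in> hom_R G N" by (rule hom_R_trans[OF assms(1,2) G.wf_digraph_axioms])
  note iff = stability_iff_pair_steps[OF \<pi> G.wf_digraph_axioms N.wf_digraph_axioms]
    stability_iff_pair_steps[OF assms(2) K.wf_digraph_axioms N.wf_digraph_axioms]
  have "(J1, J2) \<in> stability K N \<Xi>"
    if J: "J1 \<in> verts K" "J2 \<in> verts K" "state_map \<Xi> J1 = state_map \<Xi> J2" for J1 J2
  proof -
    obtain I1 I2 where I: "I1 \<in> verts G" "I2 \<in> verts G" "J1 = state_map \<Theta> I1" "J2 = state_map \<Theta> I2"
      using J(1,2) unfolding hom_RD(2)[OF assms(1), symmetric] by blast
    have stab: "(I1, I2) \<in> stability G N ?\<pi>"
      using assms(4) I J(3)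
      unfolding synchronizing_iff[OF \<pi> G.wf_digraph_axioms N.wf_digraph_axioms] by simp
    have "\<exists>L. ((L1, L2), (L, L)) \<in> (pair_step K (edge_map \<Xi>))\<^sup>*"
      if steps: "((J1, J2), (L1, L2)) \<in> (pair_step K (edge_map \<Xi>))\<^sup>*" for L1 L2
    proof -
      obtain L1' L2' where L: "((I1, I2), (L1', L2')) \<in> (pair_step G (edge_map \<Xi> \<circ> edge_map \<Theta>))\<^sup>*"
        "L1 = state_map \<Theta> L1'" "L2 = state_map \<Theta> L2'"
        using pair_steps_pull[OF assms(1) G.wf_digraph_axioms I(1,2)] steps unfolding I(3,4) by metis
      then obtain L where "((L1', L2'), (L, L)) \<in> (pair_step G (edge_map \<Xi> \<circ> edge_map \<Theta>))\<^sup>*"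
        using stab unfolding iff by auto
      then show ?thesis using pair_steps_push[OF assms(1)] unfolding L(2,3) by blast
    qed
    then show ?thesis using J unfolding iff by blast
  qed
  then show ?thesis
    unfolding synchronizing_iff[OF assms(2) K.wf_digraph_axioms N.wf_digraph_axioms] by blast
qed

section \<open>Equitable partitions and minimal graphs\<close>

text \<open>A partial row sum of the adjacency matrix. The set \<open>D\<close> may contain more
  than states, so plain preimages under state maps can be inserted.\<close>

definition edge_count :: "('a, 'b) pre_digraph \<Rightarrow> 'a \<Rightarrow> 'a set \<Rightarrow> nat" where
  "edge_count G I D = card {e \<in> out_arcs G I. head G e \<in> D}"

lemma edge_count_hom_R:
  assumes "\<Phi> \<in> hom_R G H" "I \<in> verts G"
  shows "edge_count H (state_map \<Phi> I) D = edge_count G I (state_map \<Phi> -` D)"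
proof -
  note b = hom_RD(5)[OF assms]
  have "edge_map \<Phi> ` {e \<in> out_arcs G I. head G e \<in> state_map \<Phi> -` D} =
      {f \<in> edge_map \<Phi> ` out_arcs G I. head H f \<in> D}"
    using hom_RD(4)[OF assms(1)] by auto
  then have "bij_betw (edge_map \<Phi>) {e \<in> out_arcs G I. head G e \<in> state_map \<Phi> -` D}
      {f \<in> out_arcs H (state_map \<Phi> I). head H f \<in> D}"
    using b by (auto simp: bij_betw_def intro: inj_on_subset)
  then show ?thesis
    unfolding edge_count_def by (simp add: bij_betw_same_card)
qed

lemma edge_count_cong:
  assumes "wf_digraph G" "\<And>J. J \<in> verts G \<Longrightarrow> J \<in> D \<longleftrightarrow> J \<in> D'"
  shows "edge_count G I D = edge_count G I D'"
proof -
  have "{e \<in> out_arcs G I. head G e \<in> D} = {e \<in> out_arcs G I. head G e \<in> D'}"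
    using assms wf_digraph.head_in_verts[OF assms(1)] by auto
  then show ?thesis by (simp add: edge_count_def)
qed

text \<open>A converse to \<open>edge_count_hom_R\<close>: bijections between the edges from
  \<open>I\<close> into the fiber over \<open>y\<close> and the edges from \<open>\<sigma> I\<close>
  to \<open>y\<close> are chosen and glued. The state map alone thus decides whether a
  right-resolver exists.\<close>

lemma ex_hom_R_of_edge_count:
  assumes "fin_digraph G" "fin_digraph H" "\<sigma> ` verts G = verts H"
    and "\<And>I y. I \<in> verts G \<Longrightarrow> y \<in> verts H \<Longrightarrow>
      edge_count G I (\<sigma> -` {y}) = edge_count H (\<sigma> I) {y}"
  shows "\<exists>\<phi>. (\<phi>, \<sigma>) \<in> hom_R G H"
proof -
  interpret G: fin_digraph G by fact
  interpret H: fin_digraph H by fact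
  define A where "A I y = {e \<in> out_arcs G I. \<sigma> (head G e) = y}" for I y
  define B where "B x y = {f \<in> out_arcs H x. head H f = y}" for x y
  have "\<exists>f. bij_betw f (A I y) (B (\<sigma> I) y)" if "I \<in> verts G" "y \<in> verts H" for I y
  proof (rule finite_same_card_bij)
    show "finite (A I y)" "finite (B (\<sigma> I) y)" by (simp_all add: A_def B_def)
    show "card (A I y) = card (B (\<sigma> I) y)"
      using assms(4)[OF that] by (simp add: A_def B_def edge_count_def)
  qed
  then obtain f where f: "\<And>I y. I \<in> verts G \<Longrightarrow> y \<in> verts H \<Longrightarrow> bij_betw (f I y) (A I y) (B (\<sigma> I) y)"
    by metis
  \<comment> \<open>The tail of \<open>e\<close> and the image of its head tell which of the chosen
    bijections applies.\<close>
  define \<phi> where "\<phi> e = f (tail G e) (\<sigma> (head G e)) e" for e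
  have \<phi>: "\<phi> e \<in> B (\<sigma> (tail G e)) (\<sigma> (head G e))" if "e \<in> arcs G" for e
  proof -
    have "\<sigma> (head G e) \<in> verts H" using that assms(3) by auto
    then have "bij_betw (f (tail G e) (\<sigma> (head G e))) (A (tail G e) (\<sigma> (head G e)))
        (B (\<sigma> (tail G e)) (\<sigma> (head G e)))"
      using f that by simp
    moreover have "e \<in> A (tail G e) (\<sigma> (head G e))" using that by (simp add: A_def)
    ultimately show ?thesis unfolding \<phi>_def by (rule bij_betwE[THEN bspec])
  qed
  have bij: "bij_betw \<phi> (out_arcs G I) (out_arcs H (\<sigma> I))" if I: "I \<in> verts G" for I
  proof (rule bij_betw_imageI)
    show "inj_on \<phi> (out_arcs G I)"
    proof (rule inj_onI)
      fix e e' assume e: "e \<in> out_arcs G I" "e' \<in> out_arcs G I" "\<phi> e = \<phi> e'"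
      have y: "\<sigma> (head G e) = \<sigma> (head G e')"
        using \<phi>[of e] \<phi>[of e'] e by (simp add: B_def)
      have "\<sigma> (head G e) \<in> verts H" using e(1) assms(3) by auto
      then have "inj_on (f I (\<sigma> (head G e))) (A I (\<sigma> (head G e)))"
        using f[OF I] by (simp add: bij_betw_def)
      moreover have "e \<in> A I (\<sigma> (head G e))" "e' \<in> A I (\<sigma> (head G e))"
        using e y by (simp_all add: A_def)
      moreover have "f I (\<sigma> (head G e)) e = f I (\<sigma> (head G e)) e'"
        using e y by (simp add: \<phi>_def)
      ultimately show "e = e'" by (meson inj_onD)
    qed
    show "\<phi> ` out_arcs G I = out_arcs H (\<sigma> I)"
    proof
      show "\<phi> ` out_arcs G I \<subseteq> out_arcs H (\<sigma> I)" using \<phi> by (fastforce simp: B_def)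
      show "out_arcs H (\<sigma> I) \<subseteq> \<phi> ` out_arcs G I"
      proof
        fix c assume c: "c \<in> out_arcs H (\<sigma> I)"
        then have "head H c \<in> verts H" by simp
        then have "f I (head H c) ` A I (head H c) = B (\<sigma> I) (head H c)"
          using f[OF I] by (simp add: bij_betw_def)
        moreover have "c \<in> B (\<sigma> I) (head H c)" using c by (simp add: B_def)
        ultimately obtain e where "e \<in> A I (head H c)" "c = f I (head H c) e" by blast
        then have "e \<in> out_arcs G I" "c = \<phi> e" by (auto simp: A_def \<phi>_def)
        then show "c \<in> \<phi> ` out_arcs G I" by (rule image_eqI[rotated])
      qed
    qed
  qed
  have "arcs H \<subseteq> \<phi> ` arcs G"
  proof
    fix c assume c: "c \<in> arcs H"
    then have "tail H c \<in> \<sigma> ` verts G" using assms(3) by simp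
    then obtain I where I: "I \<in> verts G" "tail H c = \<sigma> I" by blast
    then have "c \<in> \<phi> ` out_arcs G I" using bij c by (simp add: bij_betw_def)
    then show "c \<in> \<phi> ` arcs G" by auto
  qed
  moreover have "\<phi> ` arcs G \<subseteq> arcs H" using \<phi> by (auto simp: B_def)
  ultimately have "\<phi> ` arcs G = arcs H" by blast
  then have "(\<phi>, \<sigma>) \<in> hom_R G H"
    using bij assms(3) \<phi> by (auto simp: hom_R_def graph_hom_def B_def)
  then show ?thesis by blast
qed

text \<open>The induced state map on \<open>K\<close> has the right edge counts, because both counts
  can be computed in \<open>G\<close>. Only the state maps are made to commute; the edge map of
  \<open>\<Psi>\<close> comes from arbitrarily chosen bijections.\<close>

lemma hom_R_factor:
  assumes "\<Phi> \<in> hom_R G H" "\<Theta> \<in> hom_R G K" "sink_free_graph G"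
    and ker: "\<And>I I'. I \<in> verts G \<Longrightarrow> I' \<in> verts G \<Longrightarrow>
      state_map \<Theta> I = state_map \<Theta> I' \<Longrightarrow> state_map \<Phi> I = state_map \<Phi> I'"
  shows "\<exists>\<Psi> \<in> hom_R K H. \<forall>I \<in> verts G. state_map \<Psi> (state_map \<Theta> I) = state_map \<Phi> I"
proof -
  interpret G: sink_free_graph G by fact
  interpret H: sink_free_graph H using hom_R_sink_free assms(1,3) by blast
  interpret K: sink_free_graph K using hom_R_sink_free assms(2,3) by blast
  define \<sigma> where "\<sigma> k = state_map \<Phi> (SOME I. I \<in> verts G \<and> state_map \<Theta> I = k)" for k
  have \<sigma>: "\<sigma> (state_map \<Theta> I) = state_map \<Phi> I" if "I \<in> verts G" for I
  proof -
    have "(SOME I'. I' \<in> verts G \<and> state_map \<Theta> I' = state_map \<Theta> I) \<in> verts G \<and>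
        state_map \<Theta> (SOME I'. I' \<in> verts G \<and> state_map \<Theta> I' = state_map \<Theta> I) = state_map \<Theta> I"
      by (rule someI[of _ I]) (use that in simp)
    then show ?thesis unfolding \<sigma>_def using that by (blast intro: ker)
  qed
  have surj: "\<sigma> ` verts K = verts H"
    unfolding hom_RD(2)[OF assms(1), symmetric] hom_RD(2)[OF assms(2), symmetric]
    using \<sigma> by (simp add: image_image)
  have "edge_count K k (\<sigma> -` {y}) = edge_count H (\<sigma> k) {y}" if k: "k \<in> verts K" for k y
  proof -
    obtain I where I: "I \<in> verts G" "k = state_map \<Theta> I"
      using k unfolding hom_RD(2)[OF assms(2), symmetric] by blast
    have "edge_count K k (\<sigma> -` {y}) = edge_count G I (state_map \<Theta> -` \<sigma> -` {y})"
      unfolding I(2) by (rule edge_count_hom_R[OF assms(2) I(1)])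
    also have "\<dots> = edge_count G I (state_map \<Phi> -` {y})"
      by (rule edge_count_cong[OF G.wf_digraph_axioms]) (simp add: \<sigma>)
    also have "\<dots> = edge_count H (\<sigma> k) {y}"
      unfolding I(2) \<sigma>[OF I(1)] by (rule edge_count_hom_R[OF assms(1) I(1), symmetric])
    finally show ?thesis .
  qed
  then obtain \<phi> where "(\<phi>, \<sigma>) \<in> hom_R K H"
    using ex_hom_R_of_edge_count[OF K.fin_digraph_axioms H.fin_digraph_axioms surj] by blast
  then show ?thesis using \<sigma> by (intro bexI[of _ "(\<phi>, \<sigma>)"]) auto
qed

lemma digraph_iso_card_verts:
  assumes "digraph_iso G H"
  shows "card (verts G) = card (verts H)"
  using assms unfolding digraph_iso_def pre_digraph.digraph_isomorphism_def
  by (auto simp: card_image)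

text \<open>An equitable partition has a quotient onto which \<open>M\<close> right-resolves;
  minimality makes this quotient have as many states as \<open>M\<close>, so all classes are
  singletons.\<close>

lemma minimal_R_equitable_trivial:
  fixes M :: nat_graph
  assumes "minimal_R M" "equiv (verts M) R"
    and "\<And>x y z. (x, y) \<in> R \<Longrightarrow> edge_count M x (R `` {z}) = edge_count M y (R `` {z})"
  shows "R \<subseteq> Id"
proof -
  interpret sink_free_graph M using assms(1) by (simp add: minimal_R_def)
  note eq = assms(2)
  \<comment> \<open>The choice depends on the class alone, so \<open>r\<close> picks one
    representative per class.\<close>
  define r where "r x = (SOME y. y \<in> R `` {x})" for x
  have r: "(x, r x) \<in> R" if "x \<in> verts M" for x
    using someI[of "\<lambda>y. y \<in> R `` {x}" x] equiv_class_self[OF eq that] by (simp add: r_def)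
  have r_eq: "r x = r y \<longleftrightarrow> (x, y) \<in> R" if "x \<in> verts M" "y \<in> verts M" for x y
  proof
    assume "r x = r y"
    then show "(x, y) \<in> R"
      using r[OF that(1)] r[OF that(2)] eq by (metis equivE symD transD)
  next
    assume "(x, y) \<in> R"
    then show "r x = r y" using equiv_class_eq[OF eq] by (simp add: r_def)
  qed
  have rV: "r x \<in> verts M" if "x \<in> verts M" for x
    using r[OF that] eq by (auto simp: equiv_def refl_on_def)
  \<comment> \<open>The quotient is realized on representatives: their out-edges are kept and the
    heads redirected to representatives. It stays a \<open>nat_graph\<close>, the type over which
    \<open>minimal_R\<close> quantifies.\<close>
  define M' :: nat_graph where "M' = \<lparr>verts = r ` verts M, arcs = {e \<in> arcs M. tail M e \<in> r ` verts M},
    tail = tail M, head = r \<circ> head M\<rparr>"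
  have out: "out_arcs M' x = out_arcs M x" if "x \<in> r ` verts M" for x
    using that by (auto simp: M'_def out_arcs_def)
  interpret M': sink_free_graph M'
  proof
    show "out_arcs M' I \<noteq> {}" if "I \<in> verts M'" for I
    proof -
      have I: "I \<in> r ` verts M" using that by (simp add: M'_def)
      then have "I \<in> verts M" using rV by blast
      then show ?thesis using sink_free out[OF I] by simp
    qed
  qed (auto simp: M'_def)
  have "edge_count M x (r -` {y}) = edge_count M' (r x) {y}" if x: "x \<in> verts M" and y: "y \<in> verts M'" for x y
  proof -
    obtain z where z: "z \<in> verts M" "y = r z" using y by (auto simp: M'_def)
    have class_iff: "w \<in> r -` {y} \<longleftrightarrow> w \<in> R `` {z}" if "w \<in> verts M" for w
      using r_eq[OF z(1) that] z(2) by auto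
    have "edge_count M x (r -` {y}) = edge_count M x (R `` {z})"
      by (rule edge_count_cong[OF wf_digraph_axioms class_iff])
    also have "\<dots> = edge_count M (r x) (R `` {z})" by (rule assms(3)[OF r[OF x]])
    also have "\<dots> = edge_count M (r x) (r -` {y})"
      by (rule edge_count_cong[OF wf_digraph_axioms class_iff[symmetric]])
    also have "\<dots> = edge_count M' (r x) {y}"
      using out[of "r x"] x by (simp add: edge_count_def) (simp add: M'_def)
    finally show ?thesis .
  qed
  then have "\<exists>\<phi>. (\<phi>, r) \<in> hom_R M M'"
    by (intro ex_hom_R_of_edge_count[OF fin_digraph_axioms M'.fin_digraph_axioms]) (simp_all add: M'_def)
  then have "leq_R M' M"
    using M'.sink_free_graph_axioms sink_free_graph_axioms by (auto simp: leq_R_def)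
  then have "card (r ` verts M) = card (verts M)"
    using assms(1) digraph_iso_card_verts[of M' M] by (simp add: minimal_R_def M'_def)
  then have inj: "inj_on r (verts M)" by (simp add: eq_card_imp_inj_on)
  show "R \<subseteq> Id"
  proof
    fix p assume p: "p \<in> R"
    obtain x y where xy: "p = (x, y)" by fastforce
    have "x \<in> verts M" "y \<in> verts M" using p xy eq by (auto simp: equiv_def refl_on_def)
    then show "p \<in> Id" using inj r_eq p xy by (auto dest: inj_onD)
  qed
qed

text \<open>
  The pairs \<open>(\<partial>\<Phi> J, \<partial>\<Phi>' J')\<close> with \<open>\<partial>\<Theta> J = \<partial>\<Theta> J'\<close> generate an equitable partition of \<open>M\<close>.
  The case \<open>I = I'\<close> says that all right-resolvers onto \<open>M\<close> have the same state map, the case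
  \<open>\<Phi> = \<Phi>'\<close> that this state map factors through that of \<open>\<Theta>\<close>.
\<close>

lemma minimal_R_state_maps:
  fixes M :: nat_graph
  assumes "minimal_R M" "\<Phi> \<in> hom_R G M" "\<Phi>' \<in> hom_R G M" "\<Theta> \<in> hom_R G K" "wf_digraph G"
    and "I \<in> verts G" "I' \<in> verts G" "state_map \<Theta> I = state_map \<Theta> I'"
  shows "state_map \<Phi> I = state_map \<Phi>' I'"
proof -
  define P where "P = {(state_map \<Phi> J, state_map \<Phi>' J') | J J'.
    J \<in> verts G \<and> J' \<in> verts G \<and> state_map \<Theta> J = state_map \<Theta> J'}"
  have PI: "(state_map \<Phi> J, state_map \<Phi>' J') \<in> P"
    if "J \<in> verts G" "J' \<in> verts G" "state_map \<Theta> J = state_map \<Theta> J'" for J J'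
    using that unfolding P_def by blast
  have P_verts: "P \<subseteq> verts M \<times> verts M"
    unfolding P_def using hom_RD(2)[OF assms(2)] hom_RD(2)[OF assms(3)] by auto
  \<comment> \<open>The closure is reflexive on all natural numbers and is cut down to the states of
    \<open>M\<close>.\<close>
  define R where "R = (P \<union> P\<inverse>)\<^sup>* \<inter> verts M \<times> verts M"
  have P_R: "P \<union> P\<inverse> \<subseteq> R" unfolding R_def using P_verts by auto
  have "sym ((P \<union> P\<inverse>)\<^sup>*)" by (intro sym_rtrancl sym_Un_converse)
  then have "sym R" unfolding R_def by (auto simp: sym_def)
  moreover have trans: "trans R" unfolding R_def by (auto intro!: transI)
  moreover have "refl_on (verts M) R" "R \<subseteq> verts M \<times> verts M" unfolding R_def by (auto simp: refl_on_def)
  ultimately have equiv: "equiv (verts M) R" by (intro equivI)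
  \<comment> \<open>Equal counts are checked on the generating pairs and later spread along
    chains.\<close>
  have step: "edge_count M x (R `` {z}) = edge_count M y (R `` {z})" if xy: "(x, y) \<in> P" for x y z
  proof -
    obtain J J' where J: "J \<in> verts G" "J' \<in> verts G" "state_map \<Theta> J = state_map \<Theta> J'"
      "x = state_map \<Phi> J" "y = state_map \<Phi>' J'" using xy unfolding P_def by blast
    let ?D = "R `` {z}"
    have closed: "a \<in> ?D \<longleftrightarrow> b \<in> ?D" if "(a, b) \<in> P" for a b
      using that P_R trans unfolding trans_def by blast
    \<comment> \<open>As \<open>?D\<close> is closed under \<open>P\<close>, its preimages under
      \<open>\<Phi>\<close> and \<open>\<Phi>'\<close> contain the same states of \<open>G\<close>,
      and these form a union of fibers of \<open>\<Theta>\<close>, the preimage of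
      \<open>D'\<close>. Edge counts into it can be read off in \<open>K\<close>, where
      \<open>J\<close> and \<open>J'\<close> have the same image.\<close>
    define D' where "D' = state_map \<Theta> ` (verts G \<inter> state_map \<Phi> -` ?D)"
    have D': "L \<in> state_map \<Phi> -` ?D \<longleftrightarrow> L \<in> state_map \<Theta> -` D'" if L: "L \<in> verts G" for L
    proof
      assume "L \<in> state_map \<Theta> -` D'"
      then obtain N where N: "N \<in> verts G" "state_map \<Phi> N \<in> ?D" "state_map \<Theta> N = state_map \<Theta> L"
        unfolding D'_def by auto
      then have "state_map \<Phi>' L \<in> ?D" using closed[OF PI[OF N(1) L N(3)]] by simp
      then show "L \<in> state_map \<Phi> -` ?D" using closed[OF PI[OF L L]] by simp
    qed (use L in \<open>auto simp: D'_def\<close>)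
    have D'': "L \<in> state_map \<Theta> -` D' \<longleftrightarrow> L \<in> state_map \<Phi>' -` ?D" if L: "L \<in> verts G" for L
      using D'[OF L] closed[OF PI[OF L L]] by simp
    have "edge_count M x ?D = edge_count G J (state_map \<Phi> -` ?D)"
      unfolding J(4) by (rule edge_count_hom_R[OF assms(2) J(1)])
    also have "\<dots> = edge_count G J (state_map \<Theta> -` D')"
      by (rule edge_count_cong[OF assms(5) D'])
    also have "\<dots> = edge_count G J' (state_map \<Theta> -` D')"
      using edge_count_hom_R[OF assms(4) J(1), of D'] edge_count_hom_R[OF assms(4) J(2), of D'] J(3)
      by simp
    also have "\<dots> = edge_count G J' (state_map \<Phi>' -` ?D)"
      by (rule edge_count_cong[OF assms(5) D''])
    also have "\<dots> = edge_count M y ?D"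
      unfolding J(5) by (rule edge_count_hom_R[OF assms(3) J(2), symmetric])
    finally show ?thesis .
  qed
  have "edge_count M x (R `` {z}) = edge_count M y (R `` {z})" if "(x, y) \<in> R" for x y z
  proof -
    have "(x, y) \<in> (P \<union> P\<inverse>)\<^sup>*" using that by (simp add: R_def)
    then show ?thesis
    proof (induction rule: rtrancl_induct)
      case (step y w)
      then show ?case using \<open>\<And>z y x. (x, y) \<in> P \<Longrightarrow> _ x y z\<close> by auto
    qed simp
  qed
  then have "R \<subseteq> Id" by (rule minimal_R_equitable_trivial[OF assms(1) equiv])
  then show ?thesis using PI[OF assms(6-8)] P_R by blast
qed

section \<open>Almost bunchy graphs\<close>

text \<open>The case of equal states, with \<open>\<Theta>\<close> taken to be
  \<open>\<Phi>\<close>. Hence \<open>Sigma_map\<close> does not depend on the resolver chosen in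
  its definition.\<close>

lemma state_map_eq_Sigma_map:
  assumes "sink_free_graph G" "\<Phi> \<in> hom_R G (min_graph G)" "I \<in> verts G"
  shows "state_map \<Phi> I = Sigma_map G I"
proof -
  interpret sink_free_graph G by fact
  show ?thesis
    unfolding Sigma_map_def
    by (rule minimal_R_state_maps[OF min_graph_leq_R(2) assms(2) some_resolver_in assms(2)
        wf_digraph_axioms assms(3,3) refl]) fact+
qed

text \<open>The state map onto the minimal graph is constant on the fibers of
  \<open>\<Theta>\<close>, so it descends to \<open>K\<close> and lifts to a right-resolver.\<close>

lemma ex_factor_min_graph:
  assumes "sink_free_graph G" "\<Theta> \<in> hom_R G K"
  shows "\<exists>\<Psi>. \<Psi> \<in> hom_R K (min_graph G)"
proof -
  interpret sink_free_graph G by fact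
  note \<Phi> = some_resolver_in[OF assms(1)]
  note min = min_graph_leq_R(2)[OF assms(1)]
  show ?thesis
    using hom_R_factor[OF \<Phi> assms(2,1) minimal_R_state_maps[OF min \<Phi> \<Phi> assms(2) wf_digraph_axioms]]
    by blast
qed

text \<open>
  Of two distinct states in a fiber, one has at most one follower over any given state of the
  minimal graph. Hence which pairs can be reached in one step from two distinct states does not
  depend on how the edges are labelled.
\<close>

lemma pair_step_almost_bunchy:
  assumes G: "sink_free_graph G" "almost_bunchy G"
    and \<Phi>: "\<Phi> \<in> hom_R G (min_graph G)" and \<Psi>: "\<Psi> \<in> hom_R G (min_graph G)"
    and I: "I1 \<in> verts G" "I2 \<in> verts G" "Sigma_map G I1 = Sigma_map G I2" "I1 \<noteq> I2"
    and step: "((I1, I2), P) \<in> pair_step G (edge_map \<Psi>)"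
  shows "((I1, I2), P) \<in> pair_step G (edge_map \<Phi>)"
proof -
  interpret G: sink_free_graph G by fact
  note \<Sigma> = state_map_eq_Sigma_map[OF G(1)]
  obtain e1 e2 where e: "e1 \<in> arcs G" "e2 \<in> arcs G" "edge_map \<Psi> e1 = edge_map \<Psi> e2"
    "tail G e1 = I1" "tail G e2 = I2" "P = (head G e1, head G e2)" using pair_stepE[OF step] .
  define J where "J = Sigma_map G (head G e1)"
  define F where "F I = followers G I \<inter> Sigma_fiber G J" for I
  have "Sigma_map G (head G e1) = Sigma_map G (head G e2)"
    using hom_RD(4)[OF \<Psi>] e(1-3) \<Sigma>[OF \<Psi>] by (metis G.head_in_verts)
  then have J2: "Sigma_map G (head G e2) = J" by (simp add: J_def)
  have FI: "head G e \<in> F (tail G e)" if "e \<in> arcs G" "Sigma_map G (head G e) = J" for e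
    using that by (auto simp: F_def followers_def Sigma_fiber_def)
  \<comment> \<open>Finiteness matters here, since an infinite set has \<open>card\<close> equal to
    0.\<close>
  have single: "x = y" if "\<not> card (F I) \<ge> 2" "x \<in> F I" "y \<in> F I" for I x y
  proof -
    have "finite (F I)" by (simp add: F_def Sigma_fiber_def)
    moreover have "card (F I) \<le> Suc 0" using that(1) by simp
    ultimately show ?thesis using that(2,3) by (simp add: card_le_Suc0_iff_eq)
  qed
  have lift: "\<exists>e'. e' \<in> arcs G \<and> tail G e' = I' \<and> edge_map \<Phi> e' = edge_map \<Phi> e \<and>
      Sigma_map G (head G e') = Sigma_map G (head G e)"
    if e: "e \<in> arcs G" and I': "I' \<in> verts G" "Sigma_map G I' = Sigma_map G (tail G e)" for e I'
  proof -
    have "edge_map \<Phi> e \<in> arcs (min_graph G)" using hom_RD(1)[OF \<Phi>] e by blast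
    moreover have "tail (min_graph G) (edge_map \<Phi> e) = state_map \<Phi> I'"
      using hom_RD(3)[OF \<Phi> e] \<Sigma>[OF \<Phi>] e I' by simp
    ultimately obtain e' where "e' \<in> arcs G" "tail G e' = I'" "edge_map \<Phi> e' = edge_map \<Phi> e"
      using hom_R_arc_lift[OF \<Phi> I'(1)] by metis
    then show ?thesis using hom_RD(4)[OF \<Phi>] e \<Sigma>[OF \<Phi>] by (metis G.head_in_verts)
  qed
  have verts: "Sigma_map G K \<in> verts (min_graph G)" if "K \<in> verts G" for K
    using hom_RD(2)[OF \<Phi>] \<Sigma>[OF \<Phi> that] that by force
  have "\<not> (card (F I1) \<ge> 2 \<and> card (F I2) \<ge> 2)"
    using G(2)[unfolded almost_bunchy_def, rule_format,
        OF verts[OF I(1)] verts[OF G.head_in_verts[OF e(1)]], of I1 I2] I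
    by (auto simp: F_def J_def Sigma_fiber_def)
  then consider "\<not> card (F I1) \<ge> 2" | "\<not> card (F I2) \<ge> 2" by blast
  then show ?thesis
  proof cases
    case 1
    \<comment> \<open>This edge may differ from \<open>e1\<close>, but \<open>I1\<close> has only
      one follower over \<open>J\<close>, so the heads agree, and only the heads enter
      \<open>P\<close>.\<close>
    obtain e' where e': "e' \<in> arcs G" "tail G e' = I1" "edge_map \<Phi> e' = edge_map \<Phi> e2"
      "Sigma_map G (head G e') = J" using lift[OF e(2) I(1)] I(3) e(5) J2 by auto
    have "head G e' = head G e1"
      using single[OF 1] FI[OF e'(1,4)] FI[OF e(1)] e' e(4) by (simp add: J_def)
    then show ?thesis using e e' by (auto intro: pair_stepI)
  next
    case 2
    obtain e' where e': "e' \<in> arcs G" "tail G e' = I2" "edge_map \<Phi> e' = edge_map \<Phi> e1"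
      "Sigma_map G (head G e') = J" using lift[OF e(1) I(2)] I(3) e(4) J_def by auto
    have "head G e' = head G e2"
      using single[OF 2] FI[OF e'(1,4)] FI[OF e(2) J2] e' e(5) by simp
    then show ?thesis using e e' by (auto intro: pair_stepI[of e1 _ e'])
  qed
qed

text \<open>Pairs reached off the diagonal are the same for both labellings. Merging steps for
  \<open>\<Phi>\<close> are also steps for \<open>\<Psi>\<close> until they first meet the diagonal,
  and there the merging is complete.\<close>

lemma stability_almost_bunchy_subset:
  assumes G: "sink_free_graph G" "almost_bunchy G"
    and \<Phi>: "\<Phi> \<in> hom_R G (min_graph G)" and \<Psi>: "\<Psi> \<in> hom_R G (min_graph G)"
  shows "stability G (min_graph G) \<Phi> \<subseteq> stability G (min_graph G) \<Psi>"
proof (rule subrelI)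
  fix I1 I2 assume stab: "(I1, I2) \<in> stability G (min_graph G) \<Phi>"
  interpret G: sink_free_graph G by fact
  interpret M: sink_free_graph "min_graph G" using hom_R_sink_free[OF G(1) \<Phi>] .
  note \<Sigma> = state_map_eq_Sigma_map[OF G(1)]
  note wf = G.wf_digraph_axioms M.wf_digraph_axioms
  note iff = stability_iff_pair_steps[OF \<Phi> wf] stability_iff_pair_steps[OF \<Psi> wf]
  note bunchy = pair_step_almost_bunchy[OF G]
  have V: "I1 \<in> verts G" "I2 \<in> verts G" "Sigma_map G I1 = Sigma_map G I2"
    using stab \<Sigma>[OF \<Phi>] by (auto simp: stability_def)
  have inv: "L1 \<in> verts G \<and> L2 \<in> verts G \<and> Sigma_map G L1 = Sigma_map G L2"
    if J: "J1 \<in> verts G" "J2 \<in> verts G" "Sigma_map G J1 = Sigma_map G J2"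
      and steps: "((J1, J2), (L1, L2)) \<in> (pair_step G (edge_map \<Xi>))\<^sup>*"
      and \<Xi>: "\<Xi> \<in> hom_R G (min_graph G)" for J1 J2 L1 L2 \<Xi>
    using pair_steps_state_map[OF \<Xi> wf(1) steps] J \<Sigma>[OF \<Xi>] by metis
  have avoid: "((I1, I2), (J1, J2)) \<in> (pair_step G (edge_map \<Phi>))\<^sup>*"
    if "((I1, I2), (J1, J2)) \<in> (pair_step G (edge_map \<Psi>))\<^sup>*" "J1 \<noteq> J2" for J1 J2
    using that
  proof (induction "(J1, J2)" arbitrary: J1 J2 rule: rtrancl_induct)
    case base
    then show ?case by simp
  next
    case (step P)
    obtain L1 L2 where P: "P = (L1, L2)" by fastforce
    \<comment> \<open>The diagonal is absorbing, so a sequence of steps ending off the diagonal has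
      avoided it throughout.\<close>
    have neq: "L1 \<noteq> L2"
    proof
      assume "L1 = L2"
      then obtain e1 e2 where e: "e1 \<in> arcs G" "e2 \<in> arcs G" "edge_map \<Psi> e1 = edge_map \<Psi> e2"
        "tail G e1 = tail G e2" "J1 = head G e1" "J2 = head G e2"
        using step(2) unfolding P by (auto elim: pair_stepE)
      have "J1 = J2"
        unfolding e(5,6) using hom_R_arc_inj[OF \<Psi> wf(1) e(1,2,4,3)] by simp
      then show False using step.prems by simp
    qed
    have L: "L1 \<in> verts G" "L2 \<in> verts G" "Sigma_map G L1 = Sigma_map G L2"
      using inv[OF V step(1)[unfolded P] \<Psi>] by simp_all
    have "((L1, L2), (J1, J2)) \<in> pair_step G (edge_map \<Phi>)"
      by (rule bunchy[OF \<Phi> \<Psi> L neq step(2)[unfolded P]])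
    then show ?case using step(3)[OF P neq] unfolding P by simp
  qed
  have merge: "\<exists>K. ((J1, J2), (K, K)) \<in> (pair_step G (edge_map \<Psi>))\<^sup>*"
    if "((J1, J2), (K, K)) \<in> (pair_step G (edge_map \<Phi>))\<^sup>*"
      "J1 \<in> verts G" "J2 \<in> verts G" "Sigma_map G J1 = Sigma_map G J2" for J1 J2 K
    using that
  proof (induction "(J1, J2)" arbitrary: J1 J2 rule: converse_rtrancl_induct)
    case base
    then show ?case by blast
  next
    case (step P)
    obtain L1 L2 where P: "P = (L1, L2)" by fastforce
    show ?case
    proof (cases "J1 = J2")
      case False
      have "((J1, J2), (L1, L2)) \<in> pair_step G (edge_map \<Psi>)"
        by (rule bunchy[OF \<Psi> \<Phi> step.prems False step(1)[unfolded P]])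
      moreover have "L1 \<in> verts G \<and> L2 \<in> verts G \<and> Sigma_map G L1 = Sigma_map G L2"
        using inv[OF step.prems r_into_rtrancl \<Phi>, OF step(1)[unfolded P]] .
      ultimately show ?thesis using step(3)[OF P] by (meson converse_rtrancl_into_rtrancl)
    qed blast
  qed
  have "\<exists>K. ((J1, J2), (K, K)) \<in> (pair_step G (edge_map \<Psi>))\<^sup>*"
    if steps: "((I1, I2), (J1, J2)) \<in> (pair_step G (edge_map \<Psi>))\<^sup>*" for J1 J2
  proof (cases "J1 = J2")
    case False
    then obtain K where "((J1, J2), (K, K)) \<in> (pair_step G (edge_map \<Phi>))\<^sup>*"
      using stab avoid[OF steps] unfolding iff by blast
    then show ?thesis using merge inv[OF V steps \<Psi>] by blast
  qed blast
  then show "(I1, I2) \<in> stability G (min_graph G) \<Psi>"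
    unfolding iff using V \<Sigma>[OF \<Psi>] by simp
qed

lemma stability_eq_sim:
  assumes "sink_free_graph G" "almost_bunchy G" "\<Phi> \<in> hom_R G (min_graph G)"
  shows "stability G (min_graph G) \<Phi> = sim G"
  using stability_almost_bunchy_subset[OF assms(1,2)] assms(3) some_resolver_in[OF assms(1)]
  unfolding sim_def by blast

section \<open>The stability quotient\<close>

text \<open>Composing \<open>\<pi>\<close> with a right-resolver from \<open>N\<close> to the
  minimal graph gives a resolver with stability relation \<open>sim G\<close>. Stability for
  \<open>\<pi>\<close> is therefore \<open>sim G\<close> restricted to the fibers of
  \<open>\<pi>\<close>.\<close>

lemma synchronizing_of_kernel_subset_sim:
  assumes "sink_free_graph G" "almost_bunchy G" "\<pi> \<in> hom_R G N"
    and "\<And>I I'. I \<in> verts G \<Longrightarrow> I' \<in> verts G \<Longrightarrow> state_map \<pi> I = state_map \<pi> I' \<Longrightarrow> (I, I') \<in> sim G"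
  shows "synchronizing G N \<pi>"
proof -
  interpret G: sink_free_graph G by fact
  interpret N: sink_free_graph N using hom_R_sink_free[OF assms(1,3)] .
  obtain \<Psi> where \<Psi>: "\<Psi> \<in> hom_R N (min_graph G)"
    using ex_factor_min_graph[OF assms(1,3)] by blast
  show ?thesis
    unfolding synchronizing_iff[OF assms(3) G.wf_digraph_axioms N.wf_digraph_axioms]
      stability_comp[OF assms(3) \<Psi> assms(1) refl]
      stability_eq_sim[OF assms(1,2) hom_R_trans[OF assms(3) \<Psi> G.wf_digraph_axioms]]
    using assms(4) by blast
qed

text \<open>Synchronization puts each fiber of \<open>\<Theta>\<close> inside a class of
  \<open>sim G\<close>, so the state map of \<open>\<pi>\<close> factors through \<open>K\<close>.
  \<open>N\<close> is any graph with the right kernel, which covers both the quotient and a copy of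
  it on natural numbers.\<close>

lemma leq_S_of_kernel_sim:
  assumes "sink_free_graph G" "almost_bunchy G" "\<pi> \<in> hom_R G N"
    and ker: "\<And>I I'. I \<in> verts G \<Longrightarrow> I' \<in> verts G \<Longrightarrow>
      state_map \<pi> I = state_map \<pi> I' \<longleftrightarrow> (I, I') \<in> sim G"
    and "leq_S K G"
  shows "leq_S N K"
proof -
  interpret G: sink_free_graph G by fact
  interpret K: sink_free_graph K using assms(5) by (simp add: leq_S_def)
  obtain \<Theta> where \<Theta>: "\<Theta> \<in> hom_R G K" "synchronizing G K \<Theta>" using assms(5) by (auto simp: leq_S_def)
  obtain \<Psi> where \<Psi>: "\<Psi> \<in> hom_R K (min_graph G)"
    using ex_factor_min_graph[OF assms(1) \<Theta>(1)] by blast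
  have "(I, I') \<in> sim G"
    if "I \<in> verts G" "I' \<in> verts G" "state_map \<Theta> I = state_map \<Theta> I'" for I I'
    using \<Theta>(2) that
    unfolding synchronizing_iff[OF \<Theta>(1) G.wf_digraph_axioms K.wf_digraph_axioms]
      stability_comp[OF \<Theta>(1) \<Psi> assms(1) refl]
      stability_eq_sim[OF assms(1,2) hom_R_trans[OF \<Theta>(1) \<Psi> G.wf_digraph_axioms]]
    by blast
  then obtain \<Xi> where \<Xi>: "\<Xi> \<in> hom_R K N" "\<And>I. I \<in> verts G \<Longrightarrow> state_map \<Xi> (state_map \<Theta> I) = state_map \<pi> I"
    using hom_R_factor[OF assms(3) \<Theta>(1) assms(1)] ker by blast
  \<comment> \<open>The composite shares its state map with \<open>\<pi>\<close>, but its edge map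
    may differ, so synchronization is derived from the kernel.\<close>
  have "synchronizing G N (edge_map \<Xi> \<circ> edge_map \<Theta>, state_map \<Xi> \<circ> state_map \<Theta>)"
    using synchronizing_of_kernel_subset_sim[OF assms(1,2) hom_R_trans[OF \<Theta>(1) \<Xi>(1) G.wf_digraph_axioms]]
      \<Xi>(2) ker by simp
  then have "synchronizing K N \<Xi>"
    by (rule synchronizing_right_factor[OF \<Theta>(1) \<Xi>(1) assms(1)])
  then show ?thesis
    using \<Xi>(1) hom_R_sink_free[OF K.sink_free_graph_axioms \<Xi>(1)] K.sink_free_graph_axioms
    by (auto simp: leq_S_def)
qed

text \<open>Invariance of stability under steps makes the heads of edge classes well defined. Each
  class of edges leaving the class of \<open>I\<close> has exactly one member starting at
  \<open>I\<close>, which gives the bijection on out-edges.\<close>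

lemma quotient_resolver:
  assumes "sink_free_graph G" "almost_bunchy G" "\<Phi> \<in> hom_R G (min_graph G)"
  shows "(\<lambda>e. edge_sim G \<Phi> `` {e}, \<lambda>I. sim G `` {I}) \<in> hom_R G (quotient_graph G \<Phi>)"
proof -
  interpret G: sink_free_graph G by fact
  interpret M: sink_free_graph "min_graph G" using hom_R_sink_free[OF assms(1,3)] .
  note sim = stability_eq_sim[OF assms, symmetric]
  have eqv: "equiv (verts G) (sim G)"
    unfolding sim by (rule equiv_stability[OF assms(3) G.wf_digraph_axioms M.wf_digraph_axioms])
  have eqe: "equiv (arcs G) (edge_sim G \<Phi>)"
  proof (rule equivI)
    show "edge_sim G \<Phi> \<subseteq> arcs G \<times> arcs G" by (auto simp: edge_sim_def)
    show "refl_on (arcs G) (edge_sim G \<Phi>)"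
      using eqv by (auto simp: edge_sim_def equiv_def refl_on_def)
    show "sym (edge_sim G \<Phi>)" "trans (edge_sim G \<Phi>)"
      using eqv by (auto simp: edge_sim_def equiv_def intro!: symI transI dest: symD transD)
  qed
  have ends: "tail (quotient_graph G \<Phi>) (edge_sim G \<Phi> `` {e}) = sim G `` {tail G e}"
    "head (quotient_graph G \<Phi>) (edge_sim G \<Phi> `` {e}) = sim G `` {head G e}"
    if "e \<in> arcs G" for e
  proof -
    \<comment> \<open>The representative that \<open>quotient_graph\<close> picks from the class of
      \<open>e\<close>; it can differ from \<open>e\<close>.\<close>
    define e' where "e' = (SOME e'. e' \<in> edge_sim G \<Phi> `` {e})"
    have "e' \<in> edge_sim G \<Phi> `` {e}"
      unfolding e'_def using equiv_class_self[OF eqe that] by (rule someI)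
    then have e': "e' \<in> arcs G" "edge_map \<Phi> e = edge_map \<Phi> e'" "(tail G e, tail G e') \<in> sim G"
      by (auto simp: edge_sim_def)
    have "((tail G e, tail G e'), (head G e, head G e')) \<in> (pair_step G (edge_map \<Phi>))\<^sup>*"
      using that e' by (blast intro: pair_stepI)
    then have "(head G e, head G e') \<in> sim G"
      using e'(3) unfolding sim
      by (rule stability_invariant[OF assms(3) G.wf_digraph_axioms M.wf_digraph_axioms, rotated])
    then show "tail (quotient_graph G \<Phi>) (edge_sim G \<Phi> `` {e}) = sim G `` {tail G e}"
      "head (quotient_graph G \<Phi>) (edge_sim G \<Phi> `` {e}) = sim G `` {head G e}"
      using equiv_class_eq[OF eqv] e'(3) by (simp_all add: quotient_graph_def e'_def)
  qed
  have verts: "verts (quotient_graph G \<Phi>) = (\<lambda>I. sim G `` {I}) ` verts G"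
    and arcs: "arcs (quotient_graph G \<Phi>) = (\<lambda>e. edge_sim G \<Phi> `` {e}) ` arcs G"
    by (auto simp: quotient_graph_def quotient_def)
  have "bij_betw (\<lambda>e. edge_sim G \<Phi> `` {e}) (out_arcs G I) (out_arcs (quotient_graph G \<Phi>) (sim G `` {I}))"
    if I: "I \<in> verts G" for I
  proof (rule bij_betw_imageI)
    show "inj_on (\<lambda>e. edge_sim G \<Phi> `` {e}) (out_arcs G I)"
    proof (rule inj_onI)
      fix e e' assume e: "e \<in> out_arcs G I" "e' \<in> out_arcs G I"
        "edge_sim G \<Phi> `` {e} = edge_sim G \<Phi> `` {e'}"
      then have "(e, e') \<in> edge_sim G \<Phi>" using eq_equiv_class[OF e(3) eqe] by simp
      then show "e = e'"
        using hom_R_arc_inj[OF assms(3) G.wf_digraph_axioms] e(1,2) by (simp add: edge_sim_def)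
    qed
    show "(\<lambda>e. edge_sim G \<Phi> `` {e}) ` out_arcs G I = out_arcs (quotient_graph G \<Phi>) (sim G `` {I})"
    proof
      show "(\<lambda>e. edge_sim G \<Phi> `` {e}) ` out_arcs G I \<subseteq> out_arcs (quotient_graph G \<Phi>) (sim G `` {I})"
        using ends arcs by auto
      show "out_arcs (quotient_graph G \<Phi>) (sim G `` {I}) \<subseteq> (\<lambda>e. edge_sim G \<Phi> `` {e}) ` out_arcs G I"
      proof
        fix c assume c: "c \<in> out_arcs (quotient_graph G \<Phi>) (sim G `` {I})"
        then obtain e where e: "e \<in> arcs G" "c = edge_sim G \<Phi> `` {e}" using arcs by auto
        then have "sim G `` {tail G e} = sim G `` {I}" using c ends(1) by simp
        then have tails: "(tail G e, I) \<in> sim G" using eq_equiv_class[OF _ eqv I] by blast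
        \<comment> \<open>Equivalent states lie over one state of the minimal graph, so
          \<open>e\<close> has an equally labelled counterpart starting at \<open>I\<close>.\<close>
        then have "state_map \<Phi> (tail G e) = state_map \<Phi> I" unfolding sim by (simp add: stability_def)
        then obtain e' where e': "e' \<in> arcs G" "tail G e' = I" "edge_map \<Phi> e' = edge_map \<Phi> e"
          using hom_R_arc_lift[OF assms(3) I, of "edge_map \<Phi> e"] hom_RD(1,3)[OF assms(3)] e(1)
          by (metis imageI)
        then have "(e, e') \<in> edge_sim G \<Phi>" using e tails by (simp add: edge_sim_def)
        then have "c = edge_sim G \<Phi> `` {e'}" using equiv_class_eq[OF eqe] e(2) by simp
        then show "c \<in> (\<lambda>e. edge_sim G \<Phi> `` {e}) ` out_arcs G I" using e' by auto
      qed
    qed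
  qed
  then show ?thesis
    by (auto simp: hom_R_def graph_hom_def verts arcs ends)
qed

text \<open>With \<open>leq_R_same_card_iso\<close> this gives antisymmetry up to isomorphism by
  counting.\<close>

lemma leq_R_card_le:
  assumes "leq_R H G"
  shows "card (verts H) + card (arcs H) \<le> card (verts G) + card (arcs G)"
proof -
  interpret sink_free_graph G using assms by (simp add: leq_R_def)
  obtain \<Phi> where "\<Phi> \<in> hom_R G H" using assms by (auto simp: leq_R_def)
  note \<Phi> = hom_RD(1,2)[OF this]
  show ?thesis
    unfolding \<Phi>[symmetric] by (intro add_mono card_image_le) simp_all
qed

lemma leq_S_imp_leq_R: "leq_S H G \<Longrightarrow> leq_R H G"
  by (auto simp: leq_S_def leq_R_def)

theorem theorem5p8:
  fixes G :: "('a, 'b) pre_digraph"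
    and \<Phi> :: "('a, 'b, nat, nat) graph_map"
  assumes "sink_free_graph G"
    and "almost_bunchy G"
    and "\<Phi> \<in> hom_R G (min_graph G)"
  shows "(\<forall>H :: ('c, 'd) pre_digraph.
            leq_S H G \<longrightarrow> minimal_S H \<longrightarrow> digraph_iso H (quotient_graph G \<Phi>)) \<and>
         minimal_S_below G (quotient_graph G \<Phi>) \<and>
         (\<forall>K :: ('e, 'f) pre_digraph.
            minimal_S_below G K \<longrightarrow> digraph_iso K (quotient_graph G \<Phi>))"
proof -
  let ?Q = "quotient_graph G \<Phi>"
  interpret G: sink_free_graph G by fact
  define \<pi> where "\<pi> = (\<lambda>e. edge_sim G \<Phi> `` {e}, \<lambda>I. sim G `` {I})"
  have \<pi>: "\<pi> \<in> hom_R G ?Q" unfolding \<pi>_def by (rule quotient_resolver[OF assms])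
  interpret M: sink_free_graph "min_graph G" using hom_R_sink_free[OF assms(1,3)] .
  interpret Q: sink_free_graph ?Q using hom_R_sink_free[OF assms(1) \<pi>] .
  have "equiv (verts G) (sim G)"
    unfolding stability_eq_sim[OF assms, symmetric]
    by (rule equiv_stability[OF assms(3) G.wf_digraph_axioms M.wf_digraph_axioms])
  then have ker: "state_map \<pi> I = state_map \<pi> I' \<longleftrightarrow> (I, I') \<in> sim G"
    if "I \<in> verts G" "I' \<in> verts G" for I I'
    using that by (simp add: \<pi>_def eq_equiv_class_iff)
  have leq: "leq_S N G" if "\<rho> \<in> hom_R G N"
      "\<And>I I'. I \<in> verts G \<Longrightarrow> I' \<in> verts G \<Longrightarrow> state_map \<rho> I = state_map \<rho> I' \<longleftrightarrow> (I, I') \<in> sim G"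
    for N :: "('x, 'y) pre_digraph" and \<rho>
    using synchronizing_of_kernel_subset_sim[OF assms(1,2) that(1)] that
      hom_R_sink_free[OF assms(1) that(1)] assms(1) by (auto simp: leq_S_def)
  have "digraph_iso K ?Q" if "leq_S K G" "leq_S K ?Q" for K :: nat_graph
    by (intro leq_R_same_card_iso leq_R_card_le leq_S_imp_leq_R that(2)
        leq_S_of_kernel_sim[OF assms(1,2) \<pi> ker that(1)])
  moreover have "leq_S ?Q G" by (rule leq[OF \<pi> ker])
  ultimately have below: "minimal_S_below G ?Q" unfolding minimal_S_below_def by blast
  \<comment> \<open>The quotient has sets as states and edges, whereas minimality is tested on
    graphs over natural numbers. A copy \<open>N\<close> of the quotient is therefore compared with
    a minimal \<open>K\<close>.\<close>
  obtain N :: nat_graph where N: "digraph_iso ?Q N" "leq_R N ?Q"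
    using ex_nat_copy[OF Q.sink_free_graph_axioms] by blast
  then obtain \<rho> where \<rho>: "\<rho> \<in> hom_R ?Q N" by (auto simp: leq_R_def)
  \<comment> \<open>Equal numbers of states make the resolver onto the copy injective on states, so
    its composite with \<open>\<pi>\<close> keeps the kernel \<open>sim G\<close>.\<close>
  have "card (state_map \<rho> ` verts ?Q) = card (verts ?Q)"
    using digraph_iso_card_verts[OF N(1)] hom_RD(2)[OF \<rho>] by simp
  then have inj: "inj_on (state_map \<rho>) (verts ?Q)" by (simp add: eq_card_imp_inj_on)
  define \<pi>' where "\<pi>' = (edge_map \<rho> \<circ> edge_map \<pi>, state_map \<rho> \<circ> state_map \<pi>)"
  have \<pi>': "\<pi>' \<in> hom_R G N" unfolding \<pi>'_def by (rule hom_R_trans[OF \<pi> \<rho> G.wf_digraph_axioms])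
  have ker': "state_map \<pi>' I = state_map \<pi>' I' \<longleftrightarrow> (I, I') \<in> sim G"
    if "I \<in> verts G" "I' \<in> verts G" for I I'
  proof -
    have "state_map \<pi> I \<in> verts ?Q" "state_map \<pi> I' \<in> verts ?Q"
      using hom_RD(2)[OF \<pi>] that by blast+
    then show ?thesis using inj ker[OF that] by (simp add: \<pi>'_def inj_on_eq_iff)
  qed
  \<comment> \<open>\<open>N\<close> lies below \<open>K\<close> as well as below \<open>G\<close>,
    so minimality of \<open>K\<close> forces an isomorphism. The types of \<open>K\<close> are left
    open because both \<open>H\<close> and \<open>K\<close> of the theorem are handled here.\<close>
  have iso: "digraph_iso K ?Q" if K: "minimal_S_below G K" for K :: "('x, 'y) pre_digraph"
  proof -
    have "leq_S N K"
      by (rule leq_S_of_kernel_sim[OF assms(1,2) \<pi>' ker'])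
        (use K in \<open>simp_all add: minimal_S_below_def\<close>)
    then have "digraph_iso N K"
      using K leq[OF \<pi>' ker'] by (simp add: minimal_S_below_def)
    then have "digraph_iso ?Q K" by (rule digraph_iso_trans[OF N(1)])
    then show ?thesis by (rule digraph_iso_swap[OF Q.wf_digraph_axioms])
  qed
  have min: "minimal_S_below G H" if "leq_S H G" "minimal_S H" for H :: "('x, 'y) pre_digraph"
    using that by (simp add: minimal_S_below_def minimal_S_def)
  show ?thesis
  proof (intro conjI allI impI below)
    show "digraph_iso H ?Q" if "leq_S H G" "minimal_S H" for H :: "('c, 'd) pre_digraph"
      by (rule iso[OF min[OF that]])
    show "digraph_iso K ?Q" if "minimal_S_below G K" for K :: "('e, 'f) pre_digraph"
      by (rule iso[OF that])
  qed
qed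

end
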